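(* For bipos $B,C,D$ there is an adjunction $$\mathrm{Bipo}(B,D^C)\equiv\mathrm{Bipo}(B\otimes C,D)$$ given by the usual adjunction of sets $\varphi_b(c)\leftrightarrow\varphi(b,c)$. Thus $\mathrm{Bipo}$ is a complete, cocomplete, closed symmetric monoidal category.
   Context: For a set $C$ let $M(C)=\coprod_{n\ge0}C^n$ be the free monoid on $C$, whose elements are words. A **planar bipo** (bi-pre-order) is a set $C$ with two relations $R^-\subseteq C\times M(C)$ and $R^+\subseteq M(C)\times C$, written $c_0\le c_1\cdots c_n$ for $(c_0;c_1\cdots c_n)\in R^-$ and $c_1\cdots c_n\le' c_0$ for $(c_1\cdots c_n;c_0)\in R^+$, such that: - $c\le c$ and $c\le' c$ for all $c\in C$; - for $n=1$: $c_0\le c_1\iff c_0\le' c_1$ (one then writes $\le$ for both relations); - if $b_0\le b_1\cdots b_n$ and $b_i\le\bar c_i$ for all $i$ (with $\bar c_i\in M(C)$), then $b_0\le\bar c_1\cdots\bar c_n$; if $b_1\cdots b_n\le b_0$ and $\bar c_i\le b_i$ for all $i$, then $\bar c_1\cdots\bar c_n\le b_0$; - if $b_0\le\bar c_1\cdots\bar c_n$ and $\bar c_i\le b_i$ for all $i$, then $b_0\le b_1\cdots b_n$; if $\bar c_1\cdots\bar c_n\le b_0$ and $b_i\le\bar c_i$ for all $i$, then $b_1\cdots b_n\le b_0$. A **bipo** is a planar bipo which is symmetric: for all $\sigma\in S_n$, $c_0\le c_1\cdots c_n\iff c_0\le c_{\sigma(1)}\cdots c_{\sigma(n)}$ and $c_1\cdots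 c_n\le c_0\iff c_{\sigma(1)}\cdots c_{\sigma(n)}\le c_0$. A map of bipos is a map of sets $\varphi$ such that $c_0\le c_1\cdots c_n\Rightarrow\varphi(c_0)\le\varphi(c_1)\cdots\varphi(c_n)$ and $c_1\cdots c_n\le c_0\Rightarrow\varphi(c_1)\cdots\varphi(c_n)\le\varphi(c_0)$. This gives the category $\mathrm{Bipo}$. **Internal Hom.** $D^C$ is the set $\mathrm{Bipo}(C,D)$ with $\varphi_0\le\varphi_1\cdots\varphi_n$ iff $\varphi_0(c)\le\varphi_1(c)\cdots\varphi_n(c)$ in $D$ for all $c\in C$, and $\varphi_1\cdots\varphi_n\le\varphi_0$ iff $\varphi_1(c)\cdots\varphi_n(c)\le\varphi_0(c)$ in $D$ for all $c\in C$. **Tensor product.** An intersection of bipo structures on a fixed set is again a bipo structure, so one can speak of the bipo generated by given relations. $B\otimes C$ is the bipo on the set $B\times C$ generated by the relations $(b,c_0)\le(b,c_1)\cdots(b,c_n)$ whenever $b\in B$ and $c_0\le c_1\cdots c_n$ in $C$; $(b_0,c)\le(b_1,c)\cdots(b_n,c)$ whenever $c\in C$ and $b_0\le b_1\cdots b_n$ in $B$; $(b,c_1)\cdots(b,c_n)\le(b,c_0)$ whenever $b\in B$ and $c_1\cdots c_n\le c_0$ in $C$; $(b_1,c)\cdots(b_n,c)\le(b_0,c)$ whenever $c\in C$ and $b_1\cdots b_n\le b_0$ in $B$. The closed symmetric monoidal structure of the claim is the one given by $\otimes$ and the internal Hom $D^C$. *)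

theory Defs
  imports "HOL-Library.FuncSet" "HOL-Combinatorics.Permutations"
begin

section \<open>Bipos and their maps\<close>

text \<open>
  Words are lists. A pair \<open>(c0, [c1, ..., cn])\<close> in \<open>Rminus\<close> means \<open>c0 \<le> c1 ... cn\<close>,
  and a pair \<open>([c1, ..., cn], c0)\<close> in \<open>Rplus\<close> means \<open>c1 ... cn \<le> c0\<close>; the empty word is allowed.
\<close>

record 'a bipo =
  carrier :: "'a set"
  Rminus :: "('a \<times> 'a list) set"
  Rplus :: "('a list \<times> 'a) set"

definition planar_bipo :: "'a bipo \<Rightarrow> bool" where
  "planar_bipo C \<longleftrightarrow>
     Rminus C \<subseteq> carrier C \<times> lists (carrier C) \<and>
     Rplus C \<subseteq> lists (carrier C) \<times> carrier C \<and>
     (\<forall>c\<in>carrier C. (c, [c]) \<in> Rminus C \<and> ([c], c) \<in> Rplus C) \<and>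
     (\<forall>c0\<in>carrier C. \<forall>c1\<in>carrier C. (c0, [c1]) \<in> Rminus C \<longleftrightarrow> ([c0], c1) \<in> Rplus C) \<and>
     (\<forall>b0 bs css. (b0, bs) \<in> Rminus C \<and> list_all2 (\<lambda>b cs. (b, cs) \<in> Rminus C) bs css
        \<longrightarrow> (b0, concat css) \<in> Rminus C) \<and>
     (\<forall>b0 bs css. (bs, b0) \<in> Rplus C \<and> list_all2 (\<lambda>cs b. (cs, b) \<in> Rplus C) css bs
        \<longrightarrow> (concat css, b0) \<in> Rplus C) \<and>
     (\<forall>b0 bs css. (b0, concat css) \<in> Rminus C \<and> list_all2 (\<lambda>cs b. (cs, b) \<in> Rplus C) css bs
        \<longrightarrow> (b0, bs) \<in> Rminus C) \<and>
     (\<forall>b0 bs css. (concat css, b0) \<in> Rplus C \<and> list_all2 (\<lambda>b cs. (b, cs) \<in> Rminus C) bs css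
        \<longrightarrow> (bs, b0) \<in> Rplus C)"

definition symmetric_bipo :: "'a bipo \<Rightarrow> bool" where
  "symmetric_bipo C \<longleftrightarrow>
     (\<forall>c0 cs \<sigma>. \<sigma> permutes {..<length cs} \<longrightarrow>
        ((c0, cs) \<in> Rminus C \<longleftrightarrow> (c0, permute_list \<sigma> cs) \<in> Rminus C) \<and>
        ((cs, c0) \<in> Rplus C \<longleftrightarrow> (permute_list \<sigma> cs, c0) \<in> Rplus C))"

definition Bipo :: "'a bipo set" where
  "Bipo = {C. planar_bipo C \<and> symmetric_bipo C}"

text \<open>
  Maps are extensional functions (equal to \<open>undefined\<close> outside the source carrier), so that
  equality of maps is equality in HOL.
\<close>

definition Hom :: "'a bipo \<Rightarrow> 'b bipo \<Rightarrow> ('a \<Rightarrow> 'b) set" where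
  "Hom C D = {\<phi> \<in> carrier C \<rightarrow>\<^sub>E carrier D.
     (\<forall>c0 cs. (c0, cs) \<in> Rminus C \<longrightarrow> (\<phi> c0, map \<phi> cs) \<in> Rminus D) \<and>
     (\<forall>c0 cs. (cs, c0) \<in> Rplus C \<longrightarrow> (map \<phi> cs, \<phi> c0) \<in> Rplus D)}"

definition bipo_id :: "'a bipo \<Rightarrow> 'a \<Rightarrow> 'a" where
  "bipo_id C = restrict id (carrier C)"

text \<open>
  Composition of extensional functions needs their source, which is written as an index. In an
  iterated composite \<open>h \<circ>\<^bsub>A\<^esub> g \<circ>\<^bsub>A\<^esub> f\<close> every index is therefore the source of the whole composite.
\<close>

abbreviation bipo_comp :: "('b \<Rightarrow> 'c) \<Rightarrow> 'a bipo \<Rightarrow> ('a \<Rightarrow> 'b) \<Rightarrow> 'a \<Rightarrow> 'c"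
    ("(_ \<circ>\<^bsub>_\<^esub>/ _)" [56, 0, 55] 55) where
  "g \<circ>\<^bsub>A\<^esub> f \<equiv> compose (carrier A) g f"

definition bipo_iso :: "'a bipo \<Rightarrow> 'b bipo \<Rightarrow> ('a \<Rightarrow> 'b) \<Rightarrow> bool" where
  "bipo_iso A B f \<longleftrightarrow> f \<in> Hom A B \<and>
     (\<exists>g\<in>Hom B A. g \<circ>\<^bsub>A\<^esub> f = bipo_id A \<and> f \<circ>\<^bsub>B\<^esub> g = bipo_id B)"


section \<open>Internal Hom, generated bipos, tensor product\<close>

definition hom_bipo :: "'c bipo \<Rightarrow> 'd bipo \<Rightarrow> ('c \<Rightarrow> 'd) bipo" where
  "hom_bipo C D =
     \<lparr>carrier = Hom C D,
      Rminus = {(\<phi>0, \<phi>s). \<phi>0 \<in> Hom C D \<and> \<phi>s \<in> lists (Hom C D) \<and>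
        (\<forall>c\<in>carrier C. (\<phi>0 c, map (\<lambda>\<phi>. \<phi> c) \<phi>s) \<in> Rminus D)},
      Rplus = {(\<phi>s, \<phi>0). \<phi>0 \<in> Hom C D \<and> \<phi>s \<in> lists (Hom C D) \<and>
        (\<forall>c\<in>carrier C. (map (\<lambda>\<phi>. \<phi> c) \<phi>s, \<phi>0 c) \<in> Rplus D)}\<rparr>"

definition generated_bipo ::
    "'a set \<Rightarrow> ('a \<times> 'a list) set \<Rightarrow> ('a list \<times> 'a) set \<Rightarrow> 'a bipo" where
  "generated_bipo X L U =
     \<lparr>carrier = X,
      Rminus = \<Inter> {Rminus C | C. C \<in> Bipo \<and> carrier C = X \<and> L \<subseteq> Rminus C \<and> U \<subseteq> Rplus C},
      Rplus = \<Inter> {Rplus C | C. C \<in> Bipo \<and> carrier C = X \<and> L \<subseteq> Rminus C \<and> U \<subseteq> Rplus C}\<rparr>"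

definition tensor :: "'b bipo \<Rightarrow> 'c bipo \<Rightarrow> ('b \<times> 'c) bipo" (infixl "\<otimes>" 70) where
  "B \<otimes> C = generated_bipo (carrier B \<times> carrier C)
     ({((b, c0), map (\<lambda>c. (b, c)) cs) | b c0 cs. b \<in> carrier B \<and> (c0, cs) \<in> Rminus C} \<union>
      {((b0, c), map (\<lambda>b. (b, c)) bs) | c b0 bs. c \<in> carrier C \<and> (b0, bs) \<in> Rminus B})
     ({(map (\<lambda>c. (b, c)) cs, (b, c0)) | b c0 cs. b \<in> carrier B \<and> (cs, c0) \<in> Rplus C} \<union>
      {(map (\<lambda>b. (b, c)) bs, (b0, c)) | c b0 bs. c \<in> carrier C \<and> (bs, b0) \<in> Rplus B})"

definition unit_bipo :: "unit bipo" where
  "unit_bipo = \<lparr>carrier = {()}, Rminus = {((), [()])}, Rplus = {([()], ())}\<rparr>"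

definition curry_map :: "'b bipo \<Rightarrow> 'c bipo \<Rightarrow> ('b \<times> 'c \<Rightarrow> 'd) \<Rightarrow> 'b \<Rightarrow> 'c \<Rightarrow> 'd" where
  "curry_map B C \<phi> = (\<lambda>b\<in>carrier B. \<lambda>c\<in>carrier C. \<phi> (b, c))"

definition uncurry_map :: "'b bipo \<Rightarrow> 'c bipo \<Rightarrow> ('b \<Rightarrow> 'c \<Rightarrow> 'd) \<Rightarrow> 'b \<times> 'c \<Rightarrow> 'd" where
  "uncurry_map B C \<psi> = (\<lambda>(b, c)\<in>carrier B \<times> carrier C. \<psi> b c)"

text \<open>The action of the internal Hom on \<open>k : C' \<rightarrow> C\<close> and \<open>g : D \<rightarrow> D'\<close>.\<close>

definition hom_map ::
    "'c2 bipo \<Rightarrow> 'c bipo \<Rightarrow> 'd bipo \<Rightarrow> ('c2 \<Rightarrow> 'c) \<Rightarrow> ('d \<Rightarrow> 'd2) \<Rightarrow> ('c \<Rightarrow> 'd) \<Rightarrow> 'c2 \<Rightarrow> 'd2" where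
  "hom_map C' C D k g = (\<lambda>\<phi>\<in>Hom C D. g \<circ>\<^bsub>C'\<^esub> \<phi> \<circ>\<^bsub>C'\<^esub> k)"

definition tensor_map ::
    "'a bipo \<Rightarrow> 'b bipo \<Rightarrow> ('a \<Rightarrow> 'a2) \<Rightarrow> ('b \<Rightarrow> 'b2) \<Rightarrow> 'a \<times> 'b \<Rightarrow> 'a2 \<times> 'b2" where
  "tensor_map A B f g = restrict (map_prod f g) (carrier A \<times> carrier B)"

definition assoc_map ::
    "'a bipo \<Rightarrow> 'b bipo \<Rightarrow> 'c bipo \<Rightarrow> ('a \<times> 'b) \<times> 'c \<Rightarrow> 'a \<times> ('b \<times> 'c)" where
  "assoc_map A B C =
     (\<lambda>((a, b), c)\<in>(carrier A \<times> carrier B) \<times> carrier C. (a, (b, c)))"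

definition lunit_map :: "'a bipo \<Rightarrow> unit \<times> 'a \<Rightarrow> 'a" where
  "lunit_map A = restrict snd (carrier unit_bipo \<times> carrier A)"

definition runit_map :: "'a bipo \<Rightarrow> 'a \<times> unit \<Rightarrow> 'a" where
  "runit_map A = restrict fst (carrier A \<times> carrier unit_bipo)"

definition swap_map :: "'a bipo \<Rightarrow> 'b bipo \<Rightarrow> 'a \<times> 'b \<Rightarrow> 'b \<times> 'a" where
  "swap_map A B = restrict prod.swap (carrier A \<times> carrier B)"


section \<open>The category of bipos\<close>

text \<open>
  HOL has no type containing the bipos on all types, and HOL formulas cannot quantify over types.
  Statements about the category of all bipos are therefore predicates on \<open>TYPE('a \<times> 'b \<times> ...)\<close>,
  where \<open>'a, 'b, ...\<close> are the independent types carrying the bipos involved; a theorem asserting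
  such a predicate with type variables asserts it for all types.
\<close>

definition Bipo_category :: "('a \<times> 'b \<times> 'c \<times> 'd) itself \<Rightarrow> bool" where
  "Bipo_category _ \<longleftrightarrow>
     (\<forall>A\<in>(Bipo :: 'a bipo set). bipo_id A \<in> Hom A A) \<and>
     (\<forall>A\<in>(Bipo :: 'a bipo set). \<forall>B\<in>(Bipo :: 'b bipo set). \<forall>C\<in>(Bipo :: 'c bipo set).
        \<forall>f\<in>Hom A B. \<forall>g\<in>Hom B C. g \<circ>\<^bsub>A\<^esub> f \<in> Hom A C) \<and>
     (\<forall>A\<in>(Bipo :: 'a bipo set). \<forall>B\<in>(Bipo :: 'b bipo set).
        \<forall>f\<in>Hom A B. f \<circ>\<^bsub>A\<^esub> bipo_id A = f \<and> bipo_id B \<circ>\<^bsub>A\<^esub> f = f) \<and>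
     (\<forall>A\<in>(Bipo :: 'a bipo set). \<forall>B\<in>(Bipo :: 'b bipo set).
      \<forall>C\<in>(Bipo :: 'c bipo set). \<forall>D\<in>(Bipo :: 'd bipo set).
        \<forall>f\<in>Hom A B. \<forall>g\<in>Hom B C. \<forall>h\<in>Hom C D. h \<circ>\<^bsub>A\<^esub> (g \<circ>\<^bsub>A\<^esub> f) = (h \<circ>\<^bsub>B\<^esub> g) \<circ>\<^bsub>A\<^esub> f)"


section \<open>Limits and colimits\<close>

record ('i, 'm) cat =
  obj :: "'i set"
  arr :: "'m set"
  src :: "'m \<Rightarrow> 'i"
  tgt :: "'m \<Rightarrow> 'i"
  idn :: "'i \<Rightarrow> 'm"
  cmp :: "'m \<Rightarrow> 'm \<Rightarrow> 'm"

definition category :: "('i, 'm) cat \<Rightarrow> bool" where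
  "category J \<longleftrightarrow>
     (\<forall>f\<in>arr J. src J f \<in> obj J \<and> tgt J f \<in> obj J) \<and>
     (\<forall>i\<in>obj J. idn J i \<in> arr J \<and> src J (idn J i) = i \<and> tgt J (idn J i) = i) \<and>
     (\<forall>f\<in>arr J. \<forall>g\<in>arr J. src J g = tgt J f \<longrightarrow>
        cmp J g f \<in> arr J \<and> src J (cmp J g f) = src J f \<and> tgt J (cmp J g f) = tgt J g) \<and>
     (\<forall>f\<in>arr J. cmp J f (idn J (src J f)) = f \<and> cmp J (idn J (tgt J f)) f = f) \<and>
     (\<forall>f\<in>arr J. \<forall>g\<in>arr J. \<forall>h\<in>arr J. src J g = tgt J f \<and> src J h = tgt J g \<longrightarrow>
        cmp J h (cmp J g f) = cmp J (cmp J h g) f)"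

text \<open>A functor from \<open>J\<close> to bipos, with object part \<open>X\<close> and arrow part \<open>F\<close>.\<close>

definition diagram ::
    "('i, 'm) cat \<Rightarrow> ('i \<Rightarrow> 'a bipo) \<Rightarrow> ('m \<Rightarrow> 'a \<Rightarrow> 'a) \<Rightarrow> bool" where
  "diagram J X F \<longleftrightarrow>
     (\<forall>i\<in>obj J. X i \<in> Bipo) \<and>
     (\<forall>f\<in>arr J. F f \<in> Hom (X (src J f)) (X (tgt J f))) \<and>
     (\<forall>i\<in>obj J. F (idn J i) = bipo_id (X i)) \<and>
     (\<forall>f\<in>arr J. \<forall>g\<in>arr J. src J g = tgt J f \<longrightarrow>
        F (cmp J g f) = F g \<circ>\<^bsub>X (src J f)\<^esub> F f)"

definition cone :: "('i, 'm) cat \<Rightarrow> ('i \<Rightarrow> 'a bipo) \<Rightarrow> ('m \<Rightarrow> 'a \<Rightarrow> 'a) \<Rightarrow>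
    'e bipo \<Rightarrow> ('i \<Rightarrow> 'e \<Rightarrow> 'a) \<Rightarrow> bool" where
  "cone J X F E \<tau> \<longleftrightarrow> E \<in> Bipo \<and> (\<forall>i\<in>obj J. \<tau> i \<in> Hom E (X i)) \<and>
     (\<forall>f\<in>arr J. F f \<circ>\<^bsub>E\<^esub> \<tau> (src J f) = \<tau> (tgt J f))"

definition cocone :: "('i, 'm) cat \<Rightarrow> ('i \<Rightarrow> 'a bipo) \<Rightarrow> ('m \<Rightarrow> 'a \<Rightarrow> 'a) \<Rightarrow>
    'e bipo \<Rightarrow> ('i \<Rightarrow> 'a \<Rightarrow> 'e) \<Rightarrow> bool" where
  "cocone J X F E \<tau> \<longleftrightarrow> E \<in> Bipo \<and> (\<forall>i\<in>obj J. \<tau> i \<in> Hom (X i) E) \<and>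
     (\<forall>f\<in>arr J. \<tau> (tgt J f) \<circ>\<^bsub>X (src J f)\<^esub> F f = \<tau> (src J f))"

text \<open>The type argument is the type of the bipos against which universality is tested.\<close>

definition limit_cone :: "'e itself \<Rightarrow> ('i, 'm) cat \<Rightarrow> ('i \<Rightarrow> 'a bipo) \<Rightarrow> ('m \<Rightarrow> 'a \<Rightarrow> 'a) \<Rightarrow>
    'l bipo \<Rightarrow> ('i \<Rightarrow> 'l \<Rightarrow> 'a) \<Rightarrow> bool" where
  "limit_cone _ J X F L \<pi> \<longleftrightarrow> cone J X F L \<pi> \<and>
     (\<forall>(E :: 'e bipo) \<tau>. cone J X F E \<tau> \<longrightarrow>
        (\<exists>!h. h \<in> Hom E L \<and> (\<forall>i\<in>obj J. \<pi> i \<circ>\<^bsub>E\<^esub> h = \<tau> i)))"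

definition colimit_cocone :: "'e itself \<Rightarrow> ('i, 'm) cat \<Rightarrow> ('i \<Rightarrow> 'a bipo) \<Rightarrow> ('m \<Rightarrow> 'a \<Rightarrow> 'a) \<Rightarrow>
    'l bipo \<Rightarrow> ('i \<Rightarrow> 'a \<Rightarrow> 'l) \<Rightarrow> bool" where
  "colimit_cocone _ J X F L \<iota> \<longleftrightarrow> cocone J X F L \<iota> \<and>
     (\<forall>(E :: 'e bipo) \<tau>. cocone J X F E \<tau> \<longrightarrow>
        (\<exists>!h. h \<in> Hom L E \<and> (\<forall>i\<in>obj J. h \<circ>\<^bsub>X i\<^esub> \<iota> i = \<tau> i)))"

text \<open>
  Limits and colimits are given by constants rather than by an existential quantifier: a
  quantifier inside a statement with type variable \<open>'e\<close> would allow the limit to depend on \<open>'e\<close>,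
  whereas one bipo has to be universal for the bipos on all types.
\<close>

definition lim_bipo ::
    "('i, 'm) cat \<Rightarrow> ('i \<Rightarrow> 'a bipo) \<Rightarrow> ('m \<Rightarrow> 'a \<Rightarrow> 'a) \<Rightarrow> ('i \<Rightarrow> 'a) bipo" where
  "lim_bipo J X F =
     (let L = {x \<in> (\<Pi>\<^sub>E i\<in>obj J. carrier (X i)). \<forall>f\<in>arr J. F f (x (src J f)) = x (tgt J f)}
      in \<lparr>carrier = L,
          Rminus = {(x0, xs). x0 \<in> L \<and> xs \<in> lists L \<and>
            (\<forall>i\<in>obj J. (x0 i, map (\<lambda>x. x i) xs) \<in> Rminus (X i))},
          Rplus = {(xs, x0). x0 \<in> L \<and> xs \<in> lists L \<and>
            (\<forall>i\<in>obj J. (map (\<lambda>x. x i) xs, x0 i) \<in> Rplus (X i))}\<rparr>)"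

definition lim_proj ::
    "('i, 'm) cat \<Rightarrow> ('i \<Rightarrow> 'a bipo) \<Rightarrow> ('m \<Rightarrow> 'a \<Rightarrow> 'a) \<Rightarrow> 'i \<Rightarrow> ('i \<Rightarrow> 'a) \<Rightarrow> 'a" where
  "lim_proj J X F i = (\<lambda>x\<in>carrier (lim_bipo J X F). x i)"

text \<open>
  The colimit lives on the colimit of sets, a quotient of the disjoint union of the carriers, and
  has the bipo structure generated by the images of all the relations.
\<close>

definition colim_rel ::
    "('i, 'm) cat \<Rightarrow> ('i \<Rightarrow> 'a bipo) \<Rightarrow> ('m \<Rightarrow> 'a \<Rightarrow> 'a) \<Rightarrow> (('i \<times> 'a) \<times> ('i \<times> 'a)) set" where
  "colim_rel J X F =
     (let r = {((src J f, x), (tgt J f, F f x)) | f x. f \<in> arr J \<and> x \<in> carrier (X (src J f))}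
      in (r \<union> r\<inverse>)\<^sup>*)"

definition colim_inj ::
    "('i, 'm) cat \<Rightarrow> ('i \<Rightarrow> 'a bipo) \<Rightarrow> ('m \<Rightarrow> 'a \<Rightarrow> 'a) \<Rightarrow> 'i \<Rightarrow> 'a \<Rightarrow> ('i \<times> 'a) set" where
  "colim_inj J X F i = (\<lambda>x\<in>carrier (X i). colim_rel J X F `` {(i, x)})"

definition colim_bipo ::
    "('i, 'm) cat \<Rightarrow> ('i \<Rightarrow> 'a bipo) \<Rightarrow> ('m \<Rightarrow> 'a \<Rightarrow> 'a) \<Rightarrow> ('i \<times> 'a) set bipo" where
  "colim_bipo J X F = generated_bipo
     ((SIGMA i:obj J. carrier (X i)) // colim_rel J X F)
     {(colim_inj J X F i x0, map (colim_inj J X F i) xs) | i x0 xs.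
        i \<in> obj J \<and> (x0, xs) \<in> Rminus (X i)}
     {(map (colim_inj J X F i) xs, colim_inj J X F i x0) | i x0 xs.
        i \<in> obj J \<and> (xs, x0) \<in> Rplus (X i)}"

definition Bipo_complete :: "('i \<times> 'm \<times> 'a \<times> 'e) itself \<Rightarrow> bool" where
  "Bipo_complete _ \<longleftrightarrow>
     (\<forall>(J :: ('i, 'm) cat) (X :: 'i \<Rightarrow> 'a bipo) F. category J \<and> diagram J X F \<longrightarrow>
        limit_cone TYPE('e) J X F (lim_bipo J X F) (lim_proj J X F))"

definition Bipo_cocomplete :: "('i \<times> 'm \<times> 'a \<times> 'e) itself \<Rightarrow> bool" where
  "Bipo_cocomplete _ \<longleftrightarrow>
     (\<forall>(J :: ('i, 'm) cat) (X :: 'i \<Rightarrow> 'a bipo) F. category J \<and> diagram J X F \<longrightarrow>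
        colimit_cocone TYPE('e) J X F (colim_bipo J X F) (colim_inj J X F))"


section \<open>Closed symmetric monoidal structure\<close>

definition Bipo_tensor_functor :: "('a \<times> 'a2 \<times> 'a3 \<times> 'b \<times> 'b2 \<times> 'b3) itself \<Rightarrow> bool" where
  "Bipo_tensor_functor _ \<longleftrightarrow>
     (\<forall>A\<in>(Bipo :: 'a bipo set). \<forall>B\<in>(Bipo :: 'b bipo set).
        A \<otimes> B \<in> Bipo \<and> tensor_map A B (bipo_id A) (bipo_id B) = bipo_id (A \<otimes> B)) \<and>
     (\<forall>A\<in>(Bipo :: 'a bipo set). \<forall>A'\<in>(Bipo :: 'a2 bipo set).
      \<forall>B\<in>(Bipo :: 'b bipo set). \<forall>B'\<in>(Bipo :: 'b2 bipo set).
      \<forall>f\<in>Hom A A'. \<forall>g\<in>Hom B B'. tensor_map A B f g \<in> Hom (A \<otimes> B) (A' \<otimes> B')) \<and>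
     (\<forall>A\<in>(Bipo :: 'a bipo set). \<forall>A'\<in>(Bipo :: 'a2 bipo set). \<forall>A''\<in>(Bipo :: 'a3 bipo set).
      \<forall>B\<in>(Bipo :: 'b bipo set). \<forall>B'\<in>(Bipo :: 'b2 bipo set). \<forall>B''\<in>(Bipo :: 'b3 bipo set).
      \<forall>f\<in>Hom A A'. \<forall>f'\<in>Hom A' A''. \<forall>g\<in>Hom B B'. \<forall>g'\<in>Hom B' B''.
        tensor_map A B (f' \<circ>\<^bsub>A\<^esub> f) (g' \<circ>\<^bsub>B\<^esub> g) =
        tensor_map A' B' f' g' \<circ>\<^bsub>A \<otimes> B\<^esub> tensor_map A B f g)"

definition Bipo_monoidal_natural :: "('a \<times> 'a2 \<times> 'b \<times> 'b2 \<times> 'c \<times> 'c2) itself \<Rightarrow> bool" where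
  "Bipo_monoidal_natural _ \<longleftrightarrow>
     (\<forall>A\<in>(Bipo :: 'a bipo set). \<forall>B\<in>(Bipo :: 'b bipo set). \<forall>C\<in>(Bipo :: 'c bipo set).
        bipo_iso ((A \<otimes> B) \<otimes> C) (A \<otimes> (B \<otimes> C)) (assoc_map A B C)) \<and>
     (\<forall>A\<in>(Bipo :: 'a bipo set). \<forall>B\<in>(Bipo :: 'b bipo set).
        bipo_iso (A \<otimes> B) (B \<otimes> A) (swap_map A B)) \<and>
     (\<forall>A\<in>(Bipo :: 'a bipo set).
        bipo_iso (unit_bipo \<otimes> A) A (lunit_map A) \<and> bipo_iso (A \<otimes> unit_bipo) A (runit_map A)) \<and>
     (\<forall>A\<in>(Bipo :: 'a bipo set). \<forall>B\<in>(Bipo :: 'b bipo set). \<forall>C\<in>(Bipo :: 'c bipo set).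
      \<forall>A'\<in>(Bipo :: 'a2 bipo set). \<forall>B'\<in>(Bipo :: 'b2 bipo set). \<forall>C'\<in>(Bipo :: 'c2 bipo set).
      \<forall>f\<in>Hom A A'. \<forall>g\<in>Hom B B'. \<forall>h\<in>Hom C C'.
        assoc_map A' B' C' \<circ>\<^bsub>(A \<otimes> B) \<otimes> C\<^esub> tensor_map (A \<otimes> B) C (tensor_map A B f g) h =
        tensor_map A (B \<otimes> C) f (tensor_map B C g h) \<circ>\<^bsub>(A \<otimes> B) \<otimes> C\<^esub> assoc_map A B C) \<and>
     (\<forall>A\<in>(Bipo :: 'a bipo set). \<forall>B\<in>(Bipo :: 'b bipo set).
      \<forall>A'\<in>(Bipo :: 'a2 bipo set). \<forall>B'\<in>(Bipo :: 'b2 bipo set).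
      \<forall>f\<in>Hom A A'. \<forall>g\<in>Hom B B'.
        swap_map A' B' \<circ>\<^bsub>A \<otimes> B\<^esub> tensor_map A B f g =
        tensor_map B A g f \<circ>\<^bsub>A \<otimes> B\<^esub> swap_map A B) \<and>
     (\<forall>A\<in>(Bipo :: 'a bipo set). \<forall>A'\<in>(Bipo :: 'a2 bipo set). \<forall>f\<in>Hom A A'.
        lunit_map A' \<circ>\<^bsub>unit_bipo \<otimes> A\<^esub> tensor_map unit_bipo A (bipo_id unit_bipo) f =
        f \<circ>\<^bsub>unit_bipo \<otimes> A\<^esub> lunit_map A \<and>
        runit_map A' \<circ>\<^bsub>A \<otimes> unit_bipo\<^esub> tensor_map A unit_bipo f (bipo_id unit_bipo) =
        f \<circ>\<^bsub>A \<otimes> unit_bipo\<^esub> runit_map A)"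

definition Bipo_monoidal_coherent :: "('a \<times> 'b \<times> 'c \<times> 'd) itself \<Rightarrow> bool" where
  "Bipo_monoidal_coherent _ \<longleftrightarrow>
     (\<forall>A\<in>(Bipo :: 'a bipo set). \<forall>B\<in>(Bipo :: 'b bipo set).
      \<forall>C\<in>(Bipo :: 'c bipo set). \<forall>D\<in>(Bipo :: 'd bipo set).
        assoc_map A B (C \<otimes> D) \<circ>\<^bsub>((A \<otimes> B) \<otimes> C) \<otimes> D\<^esub> assoc_map (A \<otimes> B) C D =
        tensor_map A ((B \<otimes> C) \<otimes> D) (bipo_id A) (assoc_map B C D)
          \<circ>\<^bsub>((A \<otimes> B) \<otimes> C) \<otimes> D\<^esub> assoc_map A (B \<otimes> C) D
          \<circ>\<^bsub>((A \<otimes> B) \<otimes> C) \<otimes> D\<^esub> tensor_map ((A \<otimes> B) \<otimes> C) D (assoc_map A B C) (bipo_id D)) \<and>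
     (\<forall>A\<in>(Bipo :: 'a bipo set). \<forall>B\<in>(Bipo :: 'b bipo set).
        tensor_map A (unit_bipo \<otimes> B) (bipo_id A) (lunit_map B)
          \<circ>\<^bsub>(A \<otimes> unit_bipo) \<otimes> B\<^esub> assoc_map A unit_bipo B =
        tensor_map (A \<otimes> unit_bipo) B (runit_map A) (bipo_id B)) \<and>
     (\<forall>A\<in>(Bipo :: 'a bipo set). \<forall>B\<in>(Bipo :: 'b bipo set). \<forall>C\<in>(Bipo :: 'c bipo set).
        assoc_map B C A
          \<circ>\<^bsub>(A \<otimes> B) \<otimes> C\<^esub> swap_map A (B \<otimes> C)
          \<circ>\<^bsub>(A \<otimes> B) \<otimes> C\<^esub> assoc_map A B C =
        tensor_map B (A \<otimes> C) (bipo_id B) (swap_map A C)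
          \<circ>\<^bsub>(A \<otimes> B) \<otimes> C\<^esub> assoc_map B A C
          \<circ>\<^bsub>(A \<otimes> B) \<otimes> C\<^esub> tensor_map (A \<otimes> B) C (swap_map A B) (bipo_id C)) \<and>
     (\<forall>A\<in>(Bipo :: 'a bipo set). \<forall>B\<in>(Bipo :: 'b bipo set).
        swap_map B A \<circ>\<^bsub>A \<otimes> B\<^esub> swap_map A B = bipo_id (A \<otimes> B))"

definition Bipo_symmetric_monoidal ::
    "('a \<times> 'b \<times> 'c \<times> 'd \<times> 'e \<times> 'f) itself \<Rightarrow> bool" where
  "Bipo_symmetric_monoidal _ \<longleftrightarrow>
     unit_bipo \<in> Bipo \<and>
     Bipo_tensor_functor TYPE('a \<times> 'b \<times> 'c \<times> 'd \<times> 'e \<times> 'f) \<and>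
     Bipo_monoidal_natural TYPE('a \<times> 'b \<times> 'c \<times> 'd \<times> 'e \<times> 'f) \<and>
     Bipo_monoidal_coherent TYPE('a \<times> 'b \<times> 'c \<times> 'd)"

definition Bipo_hom_functor :: "('c \<times> 'c2 \<times> 'c3 \<times> 'd \<times> 'd2 \<times> 'd3) itself \<Rightarrow> bool" where
  "Bipo_hom_functor _ \<longleftrightarrow>
     (\<forall>C\<in>(Bipo :: 'c bipo set). \<forall>D\<in>(Bipo :: 'd bipo set).
        hom_bipo C D \<in> Bipo \<and> hom_map C C D (bipo_id C) (bipo_id D) = bipo_id (hom_bipo C D)) \<and>
     (\<forall>C\<in>(Bipo :: 'c bipo set). \<forall>C'\<in>(Bipo :: 'c2 bipo set).
      \<forall>D\<in>(Bipo :: 'd bipo set). \<forall>D'\<in>(Bipo :: 'd2 bipo set).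
      \<forall>k\<in>Hom C' C. \<forall>g\<in>Hom D D'. hom_map C' C D k g \<in> Hom (hom_bipo C D) (hom_bipo C' D')) \<and>
     (\<forall>C\<in>(Bipo :: 'c bipo set). \<forall>C'\<in>(Bipo :: 'c2 bipo set). \<forall>C''\<in>(Bipo :: 'c3 bipo set).
      \<forall>D\<in>(Bipo :: 'd bipo set). \<forall>D'\<in>(Bipo :: 'd2 bipo set). \<forall>D''\<in>(Bipo :: 'd3 bipo set).
      \<forall>k\<in>Hom C' C. \<forall>k'\<in>Hom C'' C'. \<forall>g\<in>Hom D D'. \<forall>g'\<in>Hom D' D''.
        hom_map C'' C D (k \<circ>\<^bsub>C''\<^esub> k') (g' \<circ>\<^bsub>D\<^esub> g) =
        hom_map C'' C' D' k' g' \<circ>\<^bsub>hom_bipo C D\<^esub> hom_map C' C D k g)"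

definition Bipo_adjunction :: "('b \<times> 'b2 \<times> 'c \<times> 'c2 \<times> 'd \<times> 'd2) itself \<Rightarrow> bool" where
  "Bipo_adjunction _ \<longleftrightarrow>
     (\<forall>B\<in>(Bipo :: 'b bipo set). \<forall>C\<in>(Bipo :: 'c bipo set). \<forall>D\<in>(Bipo :: 'd bipo set).
        bij_betw (curry_map B C) (Hom (B \<otimes> C) D) (Hom B (hom_bipo C D)) \<and>
        (\<forall>\<phi>\<in>Hom (B \<otimes> C) D. uncurry_map B C (curry_map B C \<phi>) = \<phi>) \<and>
        (\<forall>\<psi>\<in>Hom B (hom_bipo C D). curry_map B C (uncurry_map B C \<psi>) = \<psi>)) \<and>
     (\<forall>B\<in>(Bipo :: 'b bipo set). \<forall>C\<in>(Bipo :: 'c bipo set). \<forall>D\<in>(Bipo :: 'd bipo set).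
      \<forall>B'\<in>(Bipo :: 'b2 bipo set). \<forall>C'\<in>(Bipo :: 'c2 bipo set). \<forall>D'\<in>(Bipo :: 'd2 bipo set).
      \<forall>f\<in>Hom B' B. \<forall>k\<in>Hom C' C. \<forall>g\<in>Hom D D'. \<forall>\<phi>\<in>Hom (B \<otimes> C) D.
        curry_map B' C' (g \<circ>\<^bsub>B' \<otimes> C'\<^esub> \<phi> \<circ>\<^bsub>B' \<otimes> C'\<^esub> tensor_map B' C' f k) =
        hom_map C' C D k g \<circ>\<^bsub>B'\<^esub> curry_map B C \<phi> \<circ>\<^bsub>B'\<^esub> f)"

definition Bipo_closed_symmetric_monoidal ::
    "('a \<times> 'b \<times> 'c \<times> 'd \<times> 'e \<times> 'f) itself \<Rightarrow> bool" where
  "Bipo_closed_symmetric_monoidal _ \<longleftrightarrow>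
     Bipo_symmetric_monoidal TYPE('a \<times> 'b \<times> 'c \<times> 'd \<times> 'e \<times> 'f) \<and>
     Bipo_hom_functor TYPE('a \<times> 'b \<times> 'c \<times> 'd \<times> 'e \<times> 'f) \<and>
     Bipo_adjunction TYPE('a \<times> 'b \<times> 'c \<times> 'd \<times> 'e \<times> 'f)"

end

theory Submission
  imports Defs
begin

text \<open>
  For maps \<open>f\<^sub>i : X \<rightarrow> D\<^sub>i\<close> from a set to bipos, the relations on \<open>X\<close> that every \<open>f\<^sub>i\<close> preserves form a
  bipo structure. Limits and internal Homs are of this form. Pulling back along a single map shows
  that a map out of a generated bipo only has to preserve the generating relations. Applied to
  \<open>B \<otimes> C\<close>, this says that bipo maps \<open>B \<otimes> C \<rightarrow> D\<close> are the maps which are bipo maps in each variable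
  separately, which is the adjunction; applied to the colimit of sets, it gives colimits. The
  coherence laws then hold because they hold for sets.
\<close>

text \<open>Each bipo axiom is a universally quantified condition on relations between letters and
  words, and \<open>map\<close> commutes with \<open>concat\<close>, with one-letter words and with
  \<open>permute_list\<close>; hence the axioms can be verified one component at a time. An
  intersection of bipo structures is the case of identity maps, with the structures themselves as
  indices, so generated structures are covered too. The obstacle is that a generated structure is
  known only as an intersection: its relations cannot be listed. This matters for the associator,
  whose first variable meets an arbitrary relation of A \<otimes> B rather than a generator; such a
  relation is transported by a bipo map obtained by fixing the third coordinate. Symmetry then saves
  repeating the argument for the inverse. Maps are extensional, so an identity between set maps is
  not the whole of an equation: intermediate values must also be seen to stay where the restricted
  functions are not \<open>undefined\<close>.\<close>

section \<open>The bipo axioms as introduction and elimination rules\<close>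

lemma BipoI:
  assumes "\<And>c cs. (c, cs) \<in> Rminus C \<Longrightarrow> c \<in> carrier C \<and> set cs \<subseteq> carrier C"
    and "\<And>c cs. (cs, c) \<in> Rplus C \<Longrightarrow> c \<in> carrier C \<and> set cs \<subseteq> carrier C"
    and "\<And>c. c \<in> carrier C \<Longrightarrow> (c, [c]) \<in> Rminus C"
    and "\<And>c0 c1. c0 \<in> carrier C \<Longrightarrow> c1 \<in> carrier C \<Longrightarrow>
          (c0, [c1]) \<in> Rminus C \<longleftrightarrow> ([c0], c1) \<in> Rplus C"
    and "\<And>b bs css. (b, bs) \<in> Rminus C \<Longrightarrow> list_all2 (\<lambda>b cs. (b, cs) \<in> Rminus C) bs css \<Longrightarrow>
          (b, concat css) \<in> Rminus C"
    and "\<And>b bs css. (bs, b) \<in> Rplus C \<Longrightarrow> list_all2 (\<lambda>cs b. (cs, b) \<in> Rplus C) css bs \<Longrightarrow>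
          (concat css, b) \<in> Rplus C"
    and "\<And>b bs css. (b, concat css) \<in> Rminus C \<Longrightarrow>
          list_all2 (\<lambda>cs b. (cs, b) \<in> Rplus C) css bs \<Longrightarrow> (b, bs) \<in> Rminus C"
    and "\<And>b bs css. (concat css, b) \<in> Rplus C \<Longrightarrow>
          list_all2 (\<lambda>b cs. (b, cs) \<in> Rminus C) bs css \<Longrightarrow> (bs, b) \<in> Rplus C"
    and "\<And>c cs \<sigma>. \<sigma> permutes {..<length cs} \<Longrightarrow>
          (c, cs) \<in> Rminus C \<longleftrightarrow> (c, permute_list \<sigma> cs) \<in> Rminus C"
    and "\<And>c cs \<sigma>. \<sigma> permutes {..<length cs} \<Longrightarrow>
          (cs, c) \<in> Rplus C \<longleftrightarrow> (permute_list \<sigma> cs, c) \<in> Rplus C"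
  shows "C \<in> Bipo"
proof -
  have "Rminus C \<subseteq> carrier C \<times> lists (carrier C)" "Rplus C \<subseteq> lists (carrier C) \<times> carrier C"
    using assms(1,2) by fastforce+
  \<comment> \<open>Reflexivity of \<open>Rplus\<close> comes from that of \<open>Rminus\<close>,
    because the two relations agree on one-letter words.\<close>
  moreover have "\<forall>c\<in>carrier C. (c, [c]) \<in> Rminus C \<and> ([c], c) \<in> Rplus C"
    using assms(3,4) by blast
  ultimately have "planar_bipo C"
    unfolding planar_bipo_def
    by - (intro conjI; (assumption | (intro ballI, rule assms(4), assumption+) |
          (intro allI impI, elim conjE, rule assms(5-8), assumption+)))
  moreover have "symmetric_bipo C"
    unfolding symmetric_bipo_def using assms(9,10) by blast
  ultimately show ?thesis
    by (simp add: Bipo_def)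
qed

lemma
  assumes "C \<in> Bipo"
  shows Rminus_carrier: "(c, cs) \<in> Rminus C \<Longrightarrow> c \<in> carrier C \<and> set cs \<subseteq> carrier C"
    and Rplus_carrier: "(cs, c) \<in> Rplus C \<Longrightarrow> c \<in> carrier C \<and> set cs \<subseteq> carrier C"
    and Rminus_refl: "c \<in> carrier C \<Longrightarrow> (c, [c]) \<in> Rminus C"
    and Rplus_refl: "c \<in> carrier C \<Longrightarrow> ([c], c) \<in> Rplus C"
    and Rminus_single_iff: "c0 \<in> carrier C \<Longrightarrow> c1 \<in> carrier C \<Longrightarrow>
          (c0, [c1]) \<in> Rminus C \<longleftrightarrow> ([c0], c1) \<in> Rplus C"
    and Rminus_concat: "(b, bs) \<in> Rminus C \<Longrightarrow>
          list_all2 (\<lambda>b cs. (b, cs) \<in> Rminus C) bs css \<Longrightarrow> (b, concat css) \<in> Rminus C"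
    and Rplus_concat: "(bs, b) \<in> Rplus C \<Longrightarrow>
          list_all2 (\<lambda>cs b. (cs, b) \<in> Rplus C) css bs \<Longrightarrow> (concat css, b) \<in> Rplus C"
    and Rminus_unconcat: "(b, concat css) \<in> Rminus C \<Longrightarrow>
          list_all2 (\<lambda>cs b. (cs, b) \<in> Rplus C) css bs \<Longrightarrow> (b, bs) \<in> Rminus C"
    and Rplus_unconcat: "(concat css, b) \<in> Rplus C \<Longrightarrow>
          list_all2 (\<lambda>b cs. (b, cs) \<in> Rminus C) bs css \<Longrightarrow> (bs, b) \<in> Rplus C"
    and Rminus_permute: "\<sigma> permutes {..<length cs} \<Longrightarrow>
          (c, permute_list \<sigma> cs) \<in> Rminus C \<longleftrightarrow> (c, cs) \<in> Rminus C"
    and Rplus_permute: "\<sigma> permutes {..<length cs} \<Longrightarrow>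
          (permute_list \<sigma> cs, c) \<in> Rplus C \<longleftrightarrow> (cs, c) \<in> Rplus C"
proof -
  have p: "planar_bipo C" and s: "symmetric_bipo C"
    using assms by (simp_all add: Bipo_def)
  note p = p[unfolded planar_bipo_def] and s = s[unfolded symmetric_bipo_def, rule_format]
  note p1 = p[THEN conjunct1]
    and p2 = p[THEN conjunct2, THEN conjunct1]
    and p3 = p[THEN conjunct2, THEN conjunct2, THEN conjunct1]
    and p4 = p[THEN conjunct2, THEN conjunct2, THEN conjunct2, THEN conjunct1]
  note p' = p[THEN conjunct2, THEN conjunct2, THEN conjunct2, THEN conjunct2]
  note p5 = p'[THEN conjunct1]
    and p6 = p'[THEN conjunct2, THEN conjunct1]
    and p7 = p'[THEN conjunct2, THEN conjunct2, THEN conjunct1]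
    and p8 = p'[THEN conjunct2, THEN conjunct2, THEN conjunct2]
  show "(c, cs) \<in> Rminus C \<Longrightarrow> c \<in> carrier C \<and> set cs \<subseteq> carrier C"
    using p1 by auto
  show "(cs, c) \<in> Rplus C \<Longrightarrow> c \<in> carrier C \<and> set cs \<subseteq> carrier C"
    using p2 by auto
  show "c \<in> carrier C \<Longrightarrow> (c, [c]) \<in> Rminus C" "c \<in> carrier C \<Longrightarrow> ([c], c) \<in> Rplus C"
    using p3 by simp_all
  show "c0 \<in> carrier C \<Longrightarrow> c1 \<in> carrier C \<Longrightarrow>
          (c0, [c1]) \<in> Rminus C \<longleftrightarrow> ([c0], c1) \<in> Rplus C"
    using p4 by simp
  show "(b, bs) \<in> Rminus C \<Longrightarrow>
          list_all2 (\<lambda>b cs. (b, cs) \<in> Rminus C) bs css \<Longrightarrow> (b, concat css) \<in> Rminus C"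
    by (rule p5[rule_format, OF conjI])
  show "(bs, b) \<in> Rplus C \<Longrightarrow>
          list_all2 (\<lambda>cs b. (cs, b) \<in> Rplus C) css bs \<Longrightarrow> (concat css, b) \<in> Rplus C"
    by (rule p6[rule_format, OF conjI])
  show "(b, concat css) \<in> Rminus C \<Longrightarrow>
          list_all2 (\<lambda>cs b. (cs, b) \<in> Rplus C) css bs \<Longrightarrow> (b, bs) \<in> Rminus C"
    by (rule p7[rule_format, OF conjI])
  show "(concat css, b) \<in> Rplus C \<Longrightarrow>
          list_all2 (\<lambda>b cs. (b, cs) \<in> Rminus C) bs css \<Longrightarrow> (bs, b) \<in> Rplus C"
    by (rule p8[rule_format, OF conjI])
  show "\<sigma> permutes {..<length cs} \<Longrightarrow>
          (c, permute_list \<sigma> cs) \<in> Rminus C \<longleftrightarrow> (c, cs) \<in> Rminus C"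
    "\<sigma> permutes {..<length cs} \<Longrightarrow>
          (permute_list \<sigma> cs, c) \<in> Rplus C \<longleftrightarrow> (cs, c) \<in> Rplus C"
    by (rule s[THEN conjunct1, symmetric] s[THEN conjunct2, symmetric], assumption)+
qed


section \<open>Initial and generated structures\<close>

text \<open>The initial lift of the family \<open>f\<close>. The index set is kept general to serve
  several purposes: empty for the indiscrete structure, a set of bipos with identity maps for an
  intersection, the points of a bipo with evaluation maps for an internal Hom.\<close>

definition initial_bipo :: "'x set \<Rightarrow> 'i set \<Rightarrow> ('i \<Rightarrow> 'x \<Rightarrow> 'a) \<Rightarrow> ('i \<Rightarrow> 'a bipo) \<Rightarrow> 'x bipo" where
  "initial_bipo X I f D =
     \<lparr>carrier = X,
      Rminus = {(x0, xs). x0 \<in> X \<and> xs \<in> lists X \<and>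
        (\<forall>i\<in>I. (f i x0, map (f i) xs) \<in> Rminus (D i))},
      Rplus = {(xs, x0). x0 \<in> X \<and> xs \<in> lists X \<and>
        (\<forall>i\<in>I. (map (f i) xs, f i x0) \<in> Rplus (D i))}\<rparr>"

lemma carrier_initial_bipo [simp]: "carrier (initial_bipo X I f D) = X"
  by (simp add: initial_bipo_def)

lemma Rminus_initial_bipo [simp]:
  "(x0, xs) \<in> Rminus (initial_bipo X I f D) \<longleftrightarrow>
     x0 \<in> X \<and> set xs \<subseteq> X \<and> (\<forall>i\<in>I. (f i x0, map (f i) xs) \<in> Rminus (D i))"
  by (auto simp: initial_bipo_def)

lemma Rplus_initial_bipo [simp]:
  "(xs, x0) \<in> Rplus (initial_bipo X I f D) \<longleftrightarrow>
     x0 \<in> X \<and> set xs \<subseteq> X \<and> (\<forall>i\<in>I. (map (f i) xs, f i x0) \<in> Rplus (D i))"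
  by (auto simp: initial_bipo_def)

text \<open>Carrier conditions on words are stated in \<open>initial_bipo\<close> separately from
  the components, which for empty \<open>I\<close> say nothing; this transfers them along
  \<open>list_all2\<close>.\<close>

lemma list_all2_left_subset:
  assumes "list_all2 P xs ys" "\<And>x y. P x y \<Longrightarrow> x \<in> S"
  shows "set xs \<subseteq> S"
  using assms(1) by induction (simp_all add: assms(2))

lemma list_all2_right_subset:
  assumes "list_all2 P xs ys" "\<And>x y. P x y \<Longrightarrow> y \<in> S"
  shows "set ys \<subseteq> S"
  using assms(1) by induction (simp_all add: assms(2))

text \<open>Applying \<open>map (f i)\<close> to an instance of an axiom gives an instance of the
  same axiom in \<open>D i\<close>, since mapping commutes with concatenation and permutation of
  words. Only the carrier conditions are treated apart from the components.\<close>

lemma initial_bipo_in_Bipo: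
  assumes D: "\<And>i. i \<in> I \<Longrightarrow> D i \<in> Bipo" and f: "\<And>i. i \<in> I \<Longrightarrow> f i \<in> X \<rightarrow> carrier (D i)"
  shows "initial_bipo X I f D \<in> Bipo"
proof (rule BipoI)
  let ?P = "initial_bipo X I f D"
  show "c \<in> carrier ?P \<and> set cs \<subseteq> carrier ?P" if "(c, cs) \<in> Rminus ?P" for c cs
    using that by simp
  show "c \<in> carrier ?P \<and> set cs \<subseteq> carrier ?P" if "(cs, c) \<in> Rplus ?P" for c cs
    using that by simp
  show "(c, [c]) \<in> Rminus ?P" if "c \<in> carrier ?P" for c
    using that f by (auto intro!: Rminus_refl[OF D])
  show "(c0, [c1]) \<in> Rminus ?P \<longleftrightarrow> ([c0], c1) \<in> Rplus ?P"
    if "c0 \<in> carrier ?P" "c1 \<in> carrier ?P" for c0 c1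
    using that f by (auto simp: Rminus_single_iff[OF D] Pi_iff)
  have map_minus: "list_all2 (\<lambda>b cs. (b, cs) \<in> Rminus (D i)) (map (f i) bs) (map (map (f i)) css)"
    if "list_all2 (\<lambda>b cs. (b, cs) \<in> Rminus ?P) bs css" "i \<in> I" for bs css i
    using that by (auto simp: list.rel_map elim: list.rel_mono_strong)
  have map_plus: "list_all2 (\<lambda>cs b. (cs, b) \<in> Rplus (D i)) (map (map (f i)) css) (map (f i) bs)"
    if "list_all2 (\<lambda>cs b. (cs, b) \<in> Rplus ?P) css bs" "i \<in> I" for bs css i
    using that by (auto simp: list.rel_map elim: list.rel_mono_strong)
  show "(b, concat css) \<in> Rminus ?P"
    if b: "(b, bs) \<in> Rminus ?P" and a: "list_all2 (\<lambda>b cs. (b, cs) \<in> Rminus ?P) bs css" for b bs css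
  proof -
    have "set css \<subseteq> lists X"
      by (rule list_all2_right_subset[OF a]) auto
    then show ?thesis
      using b map_minus[OF a] by (auto simp: map_concat intro: Rminus_concat[OF D])
  qed
  show "(concat css, b) \<in> Rplus ?P"
    if b: "(bs, b) \<in> Rplus ?P" and a: "list_all2 (\<lambda>cs b. (cs, b) \<in> Rplus ?P) css bs" for b bs css
  proof -
    have "set css \<subseteq> lists X"
      by (rule list_all2_left_subset[OF a]) auto
    then show ?thesis
      using b map_plus[OF a] by (auto simp: map_concat intro: Rplus_concat[OF D])
  qed
  show "(b, bs) \<in> Rminus ?P"
    if b: "(b, concat css) \<in> Rminus ?P" and a: "list_all2 (\<lambda>cs b. (cs, b) \<in> Rplus ?P) css bs"
    for b bs css
  proof -
    have "set bs \<subseteq> X"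
      by (rule list_all2_right_subset[OF a]) auto
    then show ?thesis
      using b map_plus[OF a] by (auto simp: map_concat intro: Rminus_unconcat[OF D])
  qed
  show "(bs, b) \<in> Rplus ?P"
    if b: "(concat css, b) \<in> Rplus ?P" and a: "list_all2 (\<lambda>b cs. (b, cs) \<in> Rminus ?P) bs css"
    for b bs css
  proof -
    have "set bs \<subseteq> X"
      by (rule list_all2_left_subset[OF a]) auto
    then show ?thesis
      using b map_minus[OF a] by (auto simp: map_concat intro: Rplus_unconcat[OF D])
  qed
  show "(c, cs) \<in> Rminus ?P \<longleftrightarrow> (c, permute_list \<sigma> cs) \<in> Rminus ?P"
    if "\<sigma> permutes {..<length cs}" for c cs \<sigma>
    using Rminus_permute[OF D, of _ \<sigma> "map (f _) cs"] that
    by (simp add: permute_list_map set_permute_list)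
  show "(cs, c) \<in> Rplus ?P \<longleftrightarrow> (permute_list \<sigma> cs, c) \<in> Rplus ?P"
    if "\<sigma> permutes {..<length cs}" for c cs \<sigma>
    using Rplus_permute[OF D, of _ \<sigma> "map (f _) cs"] that
    by (simp add: permute_list_map set_permute_list)
qed

section \<open>Bipo structures generated by relations\<close>

lemma carrier_generated_bipo [simp]: "carrier (generated_bipo X L U) = X"
  by (simp add: generated_bipo_def)

lemma Rminus_generated_bipo_iff:
  "p \<in> Rminus (generated_bipo X L U) \<longleftrightarrow>
     (\<forall>C\<in>Bipo. carrier C = X \<longrightarrow> L \<subseteq> Rminus C \<longrightarrow> U \<subseteq> Rplus C \<longrightarrow> p \<in> Rminus C)"
  by (auto simp: generated_bipo_def)

lemma Rplus_generated_bipo_iff: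
  "p \<in> Rplus (generated_bipo X L U) \<longleftrightarrow>
     (\<forall>C\<in>Bipo. carrier C = X \<longrightarrow> L \<subseteq> Rminus C \<longrightarrow> U \<subseteq> Rplus C \<longrightarrow> p \<in> Rplus C)"
  by (auto simp: generated_bipo_def)

lemma generated_bipo_Rminus: "p \<in> L \<Longrightarrow> p \<in> Rminus (generated_bipo X L U)"
  unfolding Rminus_generated_bipo_iff by blast

lemma generated_bipo_Rplus: "p \<in> U \<Longrightarrow> p \<in> Rplus (generated_bipo X L U)"
  unfolding Rplus_generated_bipo_iff by blast

lemma generated_bipo_least:
  assumes "C \<in> Bipo" "carrier C = X" "L \<subseteq> Rminus C" "U \<subseteq> Rplus C"
  shows "Rminus (generated_bipo X L U) \<subseteq> Rminus C" "Rplus (generated_bipo X L U) \<subseteq> Rplus C"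
  using assms unfolding subset_iff[of "Rminus (generated_bipo X L U)"]
    subset_iff[of "Rplus (generated_bipo X L U)"] Rminus_generated_bipo_iff Rplus_generated_bipo_iff
  by blast+

text \<open>The intersection is the initial structure along identity maps, indexed by the very bipos
  that are intersected.\<close>

lemma generated_bipo_in_Bipo:
  assumes L: "L \<subseteq> X \<times> lists X" and U: "U \<subseteq> lists X \<times> X"
  shows "generated_bipo X L U \<in> Bipo"
proof -
  let ?I = "{C \<in> Bipo. carrier C = X \<and> L \<subseteq> Rminus C \<and> U \<subseteq> Rplus C}"
  \<comment> \<open>The indiscrete structure shows that the intersection defining the generated structure is
    not over the empty family.\<close>
  let ?T = "initial_bipo X {} (\<lambda>_::unit. id) (\<lambda>_. undefined :: 'a bipo)"
  have "?T \<in> Bipo"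
    by (rule initial_bipo_in_Bipo) simp_all
  moreover have "L \<subseteq> Rminus ?T" "U \<subseteq> Rplus ?T"
    using L U by (auto simp: subset_iff in_lists_conv_set)
  ultimately have T: "?T \<in> ?I"
    by simp
  have "(x, xs) \<in> Rminus (generated_bipo X L U) \<longleftrightarrow>
      (x, xs) \<in> Rminus (initial_bipo X ?I (\<lambda>_. id) (\<lambda>C. C))" for x xs
  proof -
    have *: "(x, xs) \<in> Rminus (generated_bipo X L U) \<longleftrightarrow> (\<forall>C\<in>?I. (x, xs) \<in> Rminus C)"
      unfolding Rminus_generated_bipo_iff by blast
    \<comment> \<open>Membership in the indiscrete structure \<open>?T\<close> is exactly the
      carrier condition that \<open>initial_bipo\<close> demands.\<close>
    have "x \<in> X \<and> set xs \<subseteq> X" if "\<forall>C\<in>?I. (x, xs) \<in> Rminus C"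
      using bspec[OF that T] by simp
    then show ?thesis
      unfolding * Rminus_initial_bipo id_apply list.map_id by (intro iffI conjI) simp_all
  qed
  moreover have "(xs, x) \<in> Rplus (generated_bipo X L U) \<longleftrightarrow>
      (xs, x) \<in> Rplus (initial_bipo X ?I (\<lambda>_. id) (\<lambda>C. C))" for x xs
  proof -
    have *: "(xs, x) \<in> Rplus (generated_bipo X L U) \<longleftrightarrow> (\<forall>C\<in>?I. (xs, x) \<in> Rplus C)"
      unfolding Rplus_generated_bipo_iff by blast
    have "x \<in> X \<and> set xs \<subseteq> X" if "\<forall>C\<in>?I. (xs, x) \<in> Rplus C"
      using bspec[OF that T] by simp
    then show ?thesis
      unfolding * Rplus_initial_bipo id_apply list.map_id by (intro iffI conjI) simp_all
  qed
  ultimately have "generated_bipo X L U = initial_bipo X ?I (\<lambda>_. id) (\<lambda>C. C)"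
    \<comment> \<open>Record equality also compares the \<open>more\<close> fields, which have type
      \<open>unit\<close>.\<close>
    by (intro bipo.equality set_eqI trans[OF unit_eq unit_eq[symmetric]])
      (simp_all only: split_paired_all carrier_initial_bipo carrier_generated_bipo)
  also have "\<dots> \<in> Bipo"
    by (rule initial_bipo_in_Bipo) auto
  finally show ?thesis .
qed


section \<open>Maps\<close>

lemma HomI:
  assumes "\<phi> \<in> carrier C \<rightarrow>\<^sub>E carrier D"
    and "\<And>c cs. (c, cs) \<in> Rminus C \<Longrightarrow> (\<phi> c, map \<phi> cs) \<in> Rminus D"
    and "\<And>c cs. (cs, c) \<in> Rplus C \<Longrightarrow> (map \<phi> cs, \<phi> c) \<in> Rplus D"
  shows "\<phi> \<in> Hom C D"
  unfolding Hom_def by (intro CollectI conjI allI impI assms)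

lemma
  assumes "\<phi> \<in> Hom C D"
  shows Hom_PiE: "\<phi> \<in> carrier C \<rightarrow>\<^sub>E carrier D"
    and Hom_closed: "c \<in> carrier C \<Longrightarrow> \<phi> c \<in> carrier D"
    and Hom_undefined: "c \<notin> carrier C \<Longrightarrow> \<phi> c = undefined"
    and Hom_minus: "(c, cs) \<in> Rminus C \<Longrightarrow> (\<phi> c, map \<phi> cs) \<in> Rminus D"
    and Hom_plus: "(cs, c) \<in> Rplus C \<Longrightarrow> (map \<phi> cs, \<phi> c) \<in> Rplus D"
proof -
  note h = assms[unfolded Hom_def, THEN CollectD]
  show 1: "\<phi> \<in> carrier C \<rightarrow>\<^sub>E carrier D"
    using h by (rule conjunct1)
  show "c \<in> carrier C \<Longrightarrow> \<phi> c \<in> carrier D" "c \<notin> carrier C \<Longrightarrow> \<phi> c = undefined"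
    using 1 by (auto intro: PiE_arb)
  show "(c, cs) \<in> Rminus C \<Longrightarrow> (\<phi> c, map \<phi> cs) \<in> Rminus D"
    by (rule h[THEN conjunct2, THEN conjunct1, rule_format])
  show "(cs, c) \<in> Rplus C \<Longrightarrow> (map \<phi> cs, \<phi> c) \<in> Rplus D"
    by (rule h[THEN conjunct2, THEN conjunct2, rule_format])
qed

lemma Hom_extensional: "\<phi> \<in> Hom C D \<Longrightarrow> \<phi> \<in> extensional (carrier C)"
  using Hom_PiE by (auto simp: PiE_def)

lemma map_restrict: "set xs \<subseteq> A \<Longrightarrow> map (restrict f A) xs = map f xs"
  by auto

text \<open>The letters in the relations of a bipo lie in its carrier, so restricting \<phi> to the
  carrier changes none of the values that occur.\<close>

lemma restrict_HomI:
  assumes "C \<in> Bipo"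
    and "\<And>c. c \<in> carrier C \<Longrightarrow> \<phi> c \<in> carrier D"
    and "\<And>c cs. (c, cs) \<in> Rminus C \<Longrightarrow> (\<phi> c, map \<phi> cs) \<in> Rminus D"
    and "\<And>c cs. (cs, c) \<in> Rplus C \<Longrightarrow> (map \<phi> cs, \<phi> c) \<in> Rplus D"
  shows "restrict \<phi> (carrier C) \<in> Hom C D"
proof (rule HomI)
  show "restrict \<phi> (carrier C) \<in> carrier C \<rightarrow>\<^sub>E carrier D"
    using assms(2) by auto
  show "(restrict \<phi> (carrier C) c, map (restrict \<phi> (carrier C)) cs) \<in> Rminus D"
    if "(c, cs) \<in> Rminus C" for c cs
    using Rminus_carrier[OF assms(1) that] assms(3)[OF that] by (simp add: map_restrict)
  show "(map (restrict \<phi> (carrier C)) cs, restrict \<phi> (carrier C) c) \<in> Rplus D"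
    if "(cs, c) \<in> Rplus C" for c cs
    using Rplus_carrier[OF assms(1) that] assms(4)[OF that] by (simp add: map_restrict)
qed

lemma bipo_id_Hom: "A \<in> Bipo \<Longrightarrow> bipo_id A \<in> Hom A A"
  unfolding bipo_id_def by (rule restrict_HomI) simp_all

lemma bipo_comp_Hom:
  assumes "A \<in> Bipo" "f \<in> Hom A B" "g \<in> Hom B C"
  shows "g \<circ>\<^bsub>A\<^esub> f \<in> Hom A C"
  unfolding compose_def
proof (rule restrict_HomI[OF assms(1)])
  show "g (f c) \<in> carrier C" if "c \<in> carrier A" for c
    using that assms by (metis Hom_closed)
  show "(g (f c), map (\<lambda>x. g (f x)) cs) \<in> Rminus C" if "(c, cs) \<in> Rminus A" for c cs
    using Hom_minus[OF assms(3) Hom_minus[OF assms(2) that]] by (simp add: o_def)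
  show "(map (\<lambda>x. g (f x)) cs, g (f c)) \<in> Rplus C" if "(cs, c) \<in> Rplus A" for c cs
    using Hom_plus[OF assms(3) Hom_plus[OF assms(2) that]] by (simp add: o_def)
qed

lemma bipo_isoI:
  assumes "f \<in> Hom A B" "g \<in> Hom B A"
    and "\<And>a. a \<in> carrier A \<Longrightarrow> g (f a) = a" "\<And>b. b \<in> carrier B \<Longrightarrow> f (g b) = b"
  shows "bipo_iso A B f"
  unfolding bipo_iso_def bipo_id_def
  using assms by (auto intro!: bexI[of _ g] simp: compose_def fun_eq_iff)

text \<open>The structure on \<open>X\<close> pulled back along \<open>\<phi>\<close> is a bipo containing the generating relations.\<close>

lemma Hom_generated_bipoI:
  assumes L: "L \<subseteq> X \<times> lists X" and U: "U \<subseteq> lists X \<times> X" and D: "D \<in> Bipo"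
    and \<phi>: "\<phi> \<in> X \<rightarrow>\<^sub>E carrier D"
    and minus: "\<And>x xs. (x, xs) \<in> L \<Longrightarrow> (\<phi> x, map \<phi> xs) \<in> Rminus D"
    and plus: "\<And>x xs. (xs, x) \<in> U \<Longrightarrow> (map \<phi> xs, \<phi> x) \<in> Rplus D"
  shows "\<phi> \<in> Hom (generated_bipo X L U) D"
proof -
  let ?P = "initial_bipo X UNIV (\<lambda>_::unit. \<phi>) (\<lambda>_. D)"
  have P: "?P \<in> Bipo"
    using D \<phi> by (intro initial_bipo_in_Bipo) auto
  have "L \<subseteq> Rminus ?P" "U \<subseteq> Rplus ?P"
    using L U minus plus by (auto simp: subset_iff in_lists_conv_set)
  then have "Rminus (generated_bipo X L U) \<subseteq> Rminus ?P" "Rplus (generated_bipo X L U) \<subseteq> Rplus ?P"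
    using P by (intro generated_bipo_least; simp)+
  then show ?thesis
    using \<phi> by (intro HomI) auto
qed

text \<open>Both sides of each law are extensional on the carrier of their source, so the laws are
  compared there, where every restriction disappears.\<close>

lemma Bipo_category: "Bipo_category TYPE('a \<times> 'b \<times> 'c \<times> 'd)"
  unfolding Bipo_category_def
proof (intro conjI ballI bipo_id_Hom bipo_comp_Hom, assumption+, goal_cases)
  case (1 A B f)
  show ?case
    by (rule extensionalityI[OF compose_extensional Hom_extensional[OF 1(3)]])
      (simp add: compose_def bipo_id_def)
next
  case (2 A B f)
  show ?case
    by (rule extensionalityI[OF compose_extensional Hom_extensional[OF 2(3)]])
      (simp add: compose_def bipo_id_def Hom_closed[OF 2(3)])
next
  case (3 A B C D f g h)
  show ?case
    by (rule extensionalityI[OF compose_extensional compose_extensional])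
      (simp add: compose_def Hom_closed[OF 3(5)])
qed


section \<open>Limits and colimits\<close>

lemma diagram_Bipo: "diagram J X F \<Longrightarrow> i \<in> obj J \<Longrightarrow> X i \<in> Bipo"
  by (simp add: diagram_def)

lemma lim_bipo_eq_initial_bipo:
  "lim_bipo J X F = initial_bipo
     {x \<in> (\<Pi>\<^sub>E i\<in>obj J. carrier (X i)). \<forall>f\<in>arr J. F f (x (src J f)) = x (tgt J f)}
     (obj J) (\<lambda>i x. x i) X"
  by (simp add: lim_bipo_def initial_bipo_def Let_def)

lemma Rminus_lim_bipo:
  "(x0, xs) \<in> Rminus (lim_bipo J X F) \<longleftrightarrow>
     x0 \<in> carrier (lim_bipo J X F) \<and> set xs \<subseteq> carrier (lim_bipo J X F) \<and>
     (\<forall>i\<in>obj J. (x0 i, map (\<lambda>x. x i) xs) \<in> Rminus (X i))"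
  unfolding lim_bipo_eq_initial_bipo Rminus_initial_bipo carrier_initial_bipo ..

lemma Rplus_lim_bipo:
  "(xs, x0) \<in> Rplus (lim_bipo J X F) \<longleftrightarrow>
     x0 \<in> carrier (lim_bipo J X F) \<and> set xs \<subseteq> carrier (lim_bipo J X F) \<and>
     (\<forall>i\<in>obj J. (map (\<lambda>x. x i) xs, x0 i) \<in> Rplus (X i))"
  unfolding lim_bipo_eq_initial_bipo Rplus_initial_bipo carrier_initial_bipo ..

lemma lim_bipo_in_Bipo:
  assumes "diagram J X F"
  shows "lim_bipo J X F \<in> Bipo"
  unfolding lim_bipo_eq_initial_bipo
  using assms by (intro initial_bipo_in_Bipo) (auto simp: diagram_Bipo)

lemma lim_proj_cone:
  assumes d: "diagram J X F"
  shows "cone J X F (lim_bipo J X F) (lim_proj J X F)"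
proof -
  have "lim_proj J X F i \<in> Hom (lim_bipo J X F) (X i)" if "i \<in> obj J" for i
    unfolding lim_proj_def
    by (rule restrict_HomI[OF lim_bipo_in_Bipo[OF d]])
      (use that in \<open>auto simp: lim_bipo_eq_initial_bipo\<close>)
  then show ?thesis
    unfolding cone_def using lim_bipo_in_Bipo[OF d]
    by (auto simp: lim_proj_def compose_def fun_eq_iff lim_bipo_eq_initial_bipo)
qed

text \<open>The equations force coordinate \<open>i\<close> of \<open>h e\<close> to be
  \<open>\<tau> i e\<close>. The resulting map preserves relations because those of the limit are
  tested coordinate by coordinate.\<close>

lemma lim_proj_universal:
  assumes J: "category J" and c: "cone J X F E \<tau>"
  shows "\<exists>!h. h \<in> Hom E (lim_bipo J X F) \<and> (\<forall>i\<in>obj J. lim_proj J X F i \<circ>\<^bsub>E\<^esub> h = \<tau> i)"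
proof
  have E: "E \<in> Bipo" and \<tau>: "\<And>i. i \<in> obj J \<Longrightarrow> \<tau> i \<in> Hom E (X i)"
    and comm: "\<And>f. f \<in> arr J \<Longrightarrow> F f \<circ>\<^bsub>E\<^esub> \<tau> (src J f) = \<tau> (tgt J f)"
    using c by (auto simp: cone_def)
  \<comment> \<open>\<open>?t e\<close> is \<open>undefined\<close> off \<open>obj J\<close>, so its
    compatibility along an arrow requires both ends of the arrow to be objects.\<close>
  have ends: "src J f \<in> obj J" "tgt J f \<in> obj J" if "f \<in> arr J" for f
    using J that by (auto simp: category_def)
  have comm': "F f (\<tau> (src J f) e) = \<tau> (tgt J f) e" if "f \<in> arr J" "e \<in> carrier E" for f e
    using fun_cong[OF comm[OF that(1)], of e] that(2) by (simp add: compose_def)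
  let ?t = "\<lambda>e. \<lambda>i\<in>obj J. \<tau> i e"
  let ?h = "restrict ?t (carrier E)"
  have t: "?t e \<in> carrier (lim_bipo J X F)" if "e \<in> carrier E" for e
    using that by (auto simp: lim_bipo_eq_initial_bipo ends comm' Hom_closed[OF \<tau>])
  have "?h \<in> Hom E (lim_bipo J X F)"
  proof (rule restrict_HomI[OF E])
    show "(?t c, map ?t cs) \<in> Rminus (lim_bipo J X F)" if "(c, cs) \<in> Rminus E" for c cs
      using Rminus_carrier[OF E that] t Hom_minus[OF \<tau> that]
      unfolding Rminus_lim_bipo by (auto simp: o_def subset_iff)
    show "(map ?t cs, ?t c) \<in> Rplus (lim_bipo J X F)" if "(cs, c) \<in> Rplus E" for c cs
      using Rplus_carrier[OF E that] t Hom_plus[OF \<tau> that]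
      unfolding Rplus_lim_bipo by (auto simp: o_def subset_iff)
  qed (use t in auto)
  moreover have "\<forall>i\<in>obj J. lim_proj J X F i \<circ>\<^bsub>E\<^esub> ?h = \<tau> i"
    using t by (auto simp: lim_proj_def compose_def fun_eq_iff Hom_undefined[OF \<tau>])
  ultimately show "?h \<in> Hom E (lim_bipo J X F) \<and> (\<forall>i\<in>obj J. lim_proj J X F i \<circ>\<^bsub>E\<^esub> ?h = \<tau> i)"
    by blast
  fix h
  assume h: "h \<in> Hom E (lim_bipo J X F) \<and> (\<forall>i\<in>obj J. lim_proj J X F i \<circ>\<^bsub>E\<^esub> h = \<tau> i)"
  show "h = ?h"
  proof
    fix e
    show "h e = ?h e"
    proof (cases "e \<in> carrier E")
      case True
      then have he: "h e \<in> carrier (lim_bipo J X F)"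
        using h by (blast intro: Hom_closed)
      have "h e i = \<tau> i e" if "i \<in> obj J" for i
      proof -
        have "(lim_proj J X F i \<circ>\<^bsub>E\<^esub> h) e = \<tau> i e"
          using h that by simp
        then show ?thesis
          using True he by (simp add: lim_proj_def compose_def)
      qed
      \<comment> \<open>Agreement on \<open>obj J\<close> determines a point of the limit, since
        families are \<open>undefined\<close> elsewhere.\<close>
      moreover have "h e \<in> extensional (obj J)"
        using he by (auto simp: lim_bipo_eq_initial_bipo PiE_def)
      ultimately show ?thesis
        using True by (auto simp: fun_eq_iff extensional_def)
    qed (simp add: Hom_undefined[OF conjunct1[OF h]])
  qed
qed

lemma Bipo_complete: "Bipo_complete TYPE('i \<times> 'm \<times> 'a \<times> 'e)"
  unfolding Bipo_complete_def limit_cone_def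
  using lim_proj_cone lim_proj_universal by blast

section \<open>Colimits as quotients of disjoint unions\<close>

text \<open>The reflexive closure relates every pair of the type to itself, hence
  \<open>UNIV\<close> in place of the disjoint union of the carriers.\<close>

lemma equiv_colim_rel: "equiv UNIV (colim_rel J X F)"
  unfolding colim_rel_def Let_def
  by (intro equivI refl_rtrancl sym_rtrancl trans_rtrancl) (auto simp: sym_def)

lemma colim_rel_arr:
  "f \<in> arr J \<Longrightarrow> x \<in> carrier (X (src J f)) \<Longrightarrow>
     ((src J f, x), (tgt J f, F f x)) \<in> colim_rel J X F"
  unfolding colim_rel_def Let_def by (rule r_into_rtrancl) blast

text \<open>This makes a cocone, read as the function \<open>case_prod \<tau>\<close> on pairs,
  descend to classes: equal values propagate along zigzags of arrows in either direction.\<close>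

lemma colim_rel_invariant:
  assumes "(p, q) \<in> colim_rel J X F"
    and "\<And>f x. f \<in> arr J \<Longrightarrow> x \<in> carrier (X (src J f)) \<Longrightarrow> P (src J f, x) = P (tgt J f, F f x)"
  shows "P p = P q"
  using assms(1) unfolding colim_rel_def Let_def
  by (induction rule: rtrancl_induct) (auto simp: assms(2))

lemma carrier_colim_bipo:
  "carrier (colim_bipo J X F) = (\<Union>i\<in>obj J. colim_inj J X F i ` carrier (X i))"
  by (auto simp: colim_bipo_def quotient_def colim_inj_def)

lemma colim_inj_undefined: "x \<notin> carrier (X i) \<Longrightarrow> colim_inj J X F i x = undefined"
  by (simp add: colim_inj_def)

lemma colim_inj_closed:
  "i \<in> obj J \<Longrightarrow> x \<in> carrier (X i) \<Longrightarrow> colim_inj J X F i x \<in> carrier (colim_bipo J X F)"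
  by (auto simp: carrier_colim_bipo)

lemma colim_generators:
  assumes "diagram J X F"
  shows "{(colim_inj J X F i x0, map (colim_inj J X F i) xs) | i x0 xs.
        i \<in> obj J \<and> (x0, xs) \<in> Rminus (X i)}
      \<subseteq> carrier (colim_bipo J X F) \<times> lists (carrier (colim_bipo J X F))"
    and "{(map (colim_inj J X F i) xs, colim_inj J X F i x0) | i x0 xs.
        i \<in> obj J \<and> (xs, x0) \<in> Rplus (X i)}
      \<subseteq> lists (carrier (colim_bipo J X F)) \<times> carrier (colim_bipo J X F)"
  using Rminus_carrier[OF diagram_Bipo[OF assms]] Rplus_carrier[OF diagram_Bipo[OF assms]]
  by (fastforce intro!: colim_inj_closed)+

text \<open>Folds the quotient back into the carrier, the form in which
  \<open>colim_generators\<close> bounds the generating relations.\<close>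

lemma colim_bipo_eq_generated_bipo:
  "colim_bipo J X F = generated_bipo (carrier (colim_bipo J X F))
     {(colim_inj J X F i x0, map (colim_inj J X F i) xs) | i x0 xs.
        i \<in> obj J \<and> (x0, xs) \<in> Rminus (X i)}
     {(map (colim_inj J X F i) xs, colim_inj J X F i x0) | i x0 xs.
        i \<in> obj J \<and> (xs, x0) \<in> Rplus (X i)}"
  by (simp add: colim_bipo_def)

lemma colim_bipo_in_Bipo: "diagram J X F \<Longrightarrow> colim_bipo J X F \<in> Bipo"
  by (subst colim_bipo_eq_generated_bipo) (intro generated_bipo_in_Bipo colim_generators)

lemma colim_inj_Hom:
  assumes "i \<in> obj J"
  shows "colim_inj J X F i \<in> Hom (X i) (colim_bipo J X F)"
proof (rule HomI)
  show "colim_inj J X F i \<in> carrier (X i) \<rightarrow>\<^sub>E carrier (colim_bipo J X F)"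
    using assms by (intro PiE_I colim_inj_closed colim_inj_undefined)
  show "(colim_inj J X F i c, map (colim_inj J X F i) cs) \<in> Rminus (colim_bipo J X F)"
    if "(c, cs) \<in> Rminus (X i)" for c cs
    unfolding colim_bipo_def by (rule generated_bipo_Rminus) (use that assms in blast)
  show "(map (colim_inj J X F i) cs, colim_inj J X F i c) \<in> Rplus (colim_bipo J X F)"
    if "(cs, c) \<in> Rplus (X i)" for c cs
    unfolding colim_bipo_def by (rule generated_bipo_Rplus) (use that assms in blast)
qed

lemma colim_inj_cocone:
  assumes d: "diagram J X F"
  shows "cocone J X F (colim_bipo J X F) (colim_inj J X F)"
proof -
  have "colim_inj J X F (tgt J f) (F f x) = colim_inj J X F (src J f) x"
    if "f \<in> arr J" "x \<in> carrier (X (src J f))" for f x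
  proof -
    have "F f \<in> Hom (X (src J f)) (X (tgt J f))"
      using d that by (simp add: diagram_def)
    then have "F f x \<in> carrier (X (tgt J f))"
      using that by (simp add: Hom_closed)
    moreover have "((src J f, x), (tgt J f, F f x)) \<in> colim_rel J X F"
      using that by (rule colim_rel_arr)
    from equiv_class_eq[OF equiv_colim_rel this]
    have "colim_rel J X F `` {(tgt J f, F f x)} = colim_rel J X F `` {(src J f, x)}" ..
    ultimately show ?thesis
      using that by (simp add: colim_inj_def)
  qed
  then have "\<forall>f\<in>arr J. colim_inj J X F (tgt J f) \<circ>\<^bsub>X (src J f)\<^esub> F f = colim_inj J X F (src J f)"
    by (auto simp: compose_def fun_eq_iff colim_inj_undefined)
  then show ?thesis
    unfolding cocone_def using colim_bipo_in_Bipo[OF d] by (simp add: colim_inj_Hom)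
qed

lemma colim_inj_universal:
  assumes d: "diagram J X F" and c: "cocone J X F E \<tau>"
  shows "\<exists>!h. h \<in> Hom (colim_bipo J X F) E \<and> (\<forall>i\<in>obj J. h \<circ>\<^bsub>X i\<^esub> colim_inj J X F i = \<tau> i)"
proof
  let ?L = "colim_bipo J X F" and ?\<iota> = "colim_inj J X F"
  have E: "E \<in> Bipo" and \<tau>: "\<And>i. i \<in> obj J \<Longrightarrow> \<tau> i \<in> Hom (X i) E"
    and comm: "\<And>f. f \<in> arr J \<Longrightarrow> \<tau> (tgt J f) \<circ>\<^bsub>X (src J f)\<^esub> F f = \<tau> (src J f)"
    using c by (auto simp: cocone_def)
  have comm': "\<tau> (tgt J f) (F f x) = \<tau> (src J f) x" if "f \<in> arr J" "x \<in> carrier (X (src J f))" for f x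
    using fun_cong[OF comm[OF that(1)], of x] that(2) by (simp add: compose_def)
  \<comment> \<open>The cocone is evaluated at an arbitrary representative; \<open>h_inj\<close>
    shows that every choice gives the same value.\<close>
  define h where "h = (\<lambda>q\<in>carrier ?L. case_prod \<tau> (SOME p. p \<in> q))"
  have h_inj: "h (?\<iota> i x) = \<tau> i x" if "i \<in> obj J" "x \<in> carrier (X i)" for i x
  proof -
    have "(i, x) \<in> ?\<iota> i x"
      using that equiv_class_self[OF equiv_colim_rel] by (simp add: colim_inj_def)
    then have "(SOME p. p \<in> ?\<iota> i x) \<in> ?\<iota> i x"
      by (rule someI)
    then have "((i, x), SOME p. p \<in> ?\<iota> i x) \<in> colim_rel J X F"
      using that by (simp add: colim_inj_def)
    then have "case_prod \<tau> (i, x) = case_prod \<tau> (SOME p. p \<in> ?\<iota> i x)"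
      by (rule colim_rel_invariant) (simp add: comm')
    then show ?thesis
      using that by (simp add: h_def colim_inj_closed)
  qed
  have map_h_inj: "map h (map (?\<iota> i) xs) = map (\<tau> i) xs"
    if "i \<in> obj J" "set xs \<subseteq> carrier (X i)" for i xs
    using that h_inj by auto
  have h_PiE: "h \<in> carrier ?L \<rightarrow>\<^sub>E carrier E"
  proof (rule PiE_I)
    show "h q \<in> carrier E" if "q \<in> carrier ?L" for q
      using that h_inj Hom_closed[OF \<tau>] by (auto simp: carrier_colim_bipo)
    show "h q = undefined" if "q \<notin> carrier ?L" for q
      using that by (simp add: h_def)
  qed
  have h_Hom: "h \<in> Hom ?L E"
  proof (subst colim_bipo_eq_generated_bipo,
      rule Hom_generated_bipoI[OF colim_generators[OF d] E h_PiE])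
    fix q qs
    assume "(q, qs) \<in> {(?\<iota> i x0, map (?\<iota> i) xs) | i x0 xs. i \<in> obj J \<and> (x0, xs) \<in> Rminus (X i)}"
    then obtain i x xs where q: "q = ?\<iota> i x" "qs = map (?\<iota> i) xs" and i: "i \<in> obj J"
      and r: "(x, xs) \<in> Rminus (X i)"
      by blast
    show "(h q, map h qs) \<in> Rminus E"
      using Rminus_carrier[OF diagram_Bipo[OF d i] r] Hom_minus[OF \<tau>[OF i] r]
      unfolding q by (simp only: h_inj map_h_inj i)
  next
    fix q qs
    assume "(qs, q) \<in> {(map (?\<iota> i) xs, ?\<iota> i x0) | i x0 xs. i \<in> obj J \<and> (xs, x0) \<in> Rplus (X i)}"
    then obtain i x xs where q: "q = ?\<iota> i x" "qs = map (?\<iota> i) xs" and i: "i \<in> obj J"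
      and r: "(xs, x) \<in> Rplus (X i)"
      by blast
    show "(map h qs, h q) \<in> Rplus E"
      using Rplus_carrier[OF diagram_Bipo[OF d i] r] Hom_plus[OF \<tau>[OF i] r]
      unfolding q by (simp only: h_inj map_h_inj i)
  qed
  have "h \<circ>\<^bsub>X i\<^esub> ?\<iota> i = \<tau> i" if i: "i \<in> obj J" for i
    by (rule extensionalityI[OF compose_extensional Hom_extensional[OF \<tau>[OF i]]])
      (simp add: compose_def h_inj i)
  then show "h \<in> Hom ?L E \<and> (\<forall>i\<in>obj J. h \<circ>\<^bsub>X i\<^esub> ?\<iota> i = \<tau> i)"
    using h_Hom by blast
  fix h'
  assume h': "h' \<in> Hom ?L E \<and> (\<forall>i\<in>obj J. h' \<circ>\<^bsub>X i\<^esub> ?\<iota> i = \<tau> i)"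
  show "h' = h"
  proof (rule extensionalityI[OF Hom_extensional[OF conjunct1[OF h']] Hom_extensional[OF h_Hom]])
    \<comment> \<open>The injections are jointly surjective, which leaves no freedom for
      \<open>h'\<close>.\<close>
    fix q assume "q \<in> carrier ?L"
    then obtain i x where ix: "i \<in> obj J" "x \<in> carrier (X i)" and q: "q = ?\<iota> i x"
      by (auto simp: carrier_colim_bipo)
    have "(h' \<circ>\<^bsub>X i\<^esub> ?\<iota> i) x = \<tau> i x"
      using h' ix by simp
    then show "h' q = h q"
      unfolding q h_inj[OF ix] using ix by (simp add: compose_def)
  qed
qed

lemma Bipo_cocomplete: "Bipo_cocomplete TYPE('i \<times> 'm \<times> 'a \<times> 'e)"
  unfolding Bipo_cocomplete_def colimit_cocone_def
  using colim_inj_cocone colim_inj_universal by blast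


section \<open>Tensor product\<close>

lemma carrier_tensor [simp]: "carrier (B \<otimes> C) = carrier B \<times> carrier C"
  by (simp add: tensor_def)

lemma tensor_generators:
  assumes "B \<in> Bipo" "C \<in> Bipo"
  shows "{((b, c0), map (\<lambda>c. (b, c)) cs) | b c0 cs. b \<in> carrier B \<and> (c0, cs) \<in> Rminus C} \<union>
      {((b0, c), map (\<lambda>b. (b, c)) bs) | c b0 bs. c \<in> carrier C \<and> (b0, bs) \<in> Rminus B}
      \<subseteq> (carrier B \<times> carrier C) \<times> lists (carrier B \<times> carrier C)"
    and "{(map (\<lambda>c. (b, c)) cs, (b, c0)) | b c0 cs. b \<in> carrier B \<and> (cs, c0) \<in> Rplus C} \<union>
      {(map (\<lambda>b. (b, c)) bs, (b0, c)) | c b0 bs. c \<in> carrier C \<and> (bs, b0) \<in> Rplus B}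
      \<subseteq> lists (carrier B \<times> carrier C) \<times> (carrier B \<times> carrier C)"
  using Rminus_carrier[OF assms(1)] Rminus_carrier[OF assms(2)]
    Rplus_carrier[OF assms(1)] Rplus_carrier[OF assms(2)]
  by fastforce+

lemma tensor_in_Bipo: "B \<in> Bipo \<Longrightarrow> C \<in> Bipo \<Longrightarrow> B \<otimes> C \<in> Bipo"
  unfolding tensor_def by (intro generated_bipo_in_Bipo tensor_generators)

lemma tensor_minus_right:
  "b \<in> carrier B \<Longrightarrow> (c, cs) \<in> Rminus C \<Longrightarrow> ((b, c), map (\<lambda>c. (b, c)) cs) \<in> Rminus (B \<otimes> C)"
  unfolding tensor_def by (intro generated_bipo_Rminus UnI1 CollectI exI conjI) (rule refl)

lemma tensor_minus_left:
  "c \<in> carrier C \<Longrightarrow> (b, bs) \<in> Rminus B \<Longrightarrow> ((b, c), map (\<lambda>b. (b, c)) bs) \<in> Rminus (B \<otimes> C)"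
  unfolding tensor_def by (intro generated_bipo_Rminus UnI2 CollectI exI conjI) (rule refl)

lemma tensor_plus_right:
  "b \<in> carrier B \<Longrightarrow> (cs, c) \<in> Rplus C \<Longrightarrow> (map (\<lambda>c. (b, c)) cs, (b, c)) \<in> Rplus (B \<otimes> C)"
  unfolding tensor_def by (intro generated_bipo_Rplus UnI1 CollectI exI conjI) (rule refl)

lemma tensor_plus_left:
  "c \<in> carrier C \<Longrightarrow> (bs, b) \<in> Rplus B \<Longrightarrow> (map (\<lambda>b. (b, c)) bs, (b, c)) \<in> Rplus (B \<otimes> C)"
  unfolding tensor_def by (intro generated_bipo_Rplus UnI2 CollectI exI conjI) (rule refl)

text \<open>The way out of a tensor product: the four preservation hypotheses match the four
  families of generators, in each of which one coordinate is constant.\<close>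

lemma restrict_Hom_tensorI:
  assumes B: "B \<in> Bipo" and C: "C \<in> Bipo" and D: "D \<in> Bipo"
    and closed: "\<And>b c. b \<in> carrier B \<Longrightarrow> c \<in> carrier C \<Longrightarrow> \<phi> (b, c) \<in> carrier D"
    and minus_right: "\<And>b c cs. b \<in> carrier B \<Longrightarrow> (c, cs) \<in> Rminus C \<Longrightarrow>
      (\<phi> (b, c), map (\<lambda>c. \<phi> (b, c)) cs) \<in> Rminus D"
    and minus_left: "\<And>c b bs. c \<in> carrier C \<Longrightarrow> (b, bs) \<in> Rminus B \<Longrightarrow>
      (\<phi> (b, c), map (\<lambda>b. \<phi> (b, c)) bs) \<in> Rminus D"
    and plus_right: "\<And>b c cs. b \<in> carrier B \<Longrightarrow> (cs, c) \<in> Rplus C \<Longrightarrow>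
      (map (\<lambda>c. \<phi> (b, c)) cs, \<phi> (b, c)) \<in> Rplus D"
    and plus_left: "\<And>c b bs. c \<in> carrier C \<Longrightarrow> (bs, b) \<in> Rplus B \<Longrightarrow>
      (map (\<lambda>b. \<phi> (b, c)) bs, \<phi> (b, c)) \<in> Rplus D"
  shows "restrict \<phi> (carrier B \<times> carrier C) \<in> Hom (B \<otimes> C) D"
  unfolding tensor_def
proof (rule Hom_generated_bipoI[OF tensor_generators[OF B C] D], goal_cases)
  case 1
  show ?case using closed by auto
next
  case (2 x xs)
  with tensor_generators(1)[OF B C] have "x \<in> carrier B \<times> carrier C" "set xs \<subseteq> carrier B \<times> carrier C"
    by blast+
  moreover from 2 have "(\<phi> x, map \<phi> xs) \<in> Rminus D"
  proof (elim UnE CollectE exE conjE Pair_inject, goal_cases)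
    case (1 b c cs)
    then show ?case using minus_right[of b c cs] by (simp add: o_def)
  next
    case (2 c b bs)
    then show ?case using minus_left[of c b bs] by (simp add: o_def)
  qed
  ultimately show ?case by (simp add: map_restrict)
next
  case (3 x xs)
  with tensor_generators(2)[OF B C] have "x \<in> carrier B \<times> carrier C" "set xs \<subseteq> carrier B \<times> carrier C"
    by blast+
  moreover from 3 have "(map \<phi> xs, \<phi> x) \<in> Rplus D"
  proof (elim UnE CollectE exE conjE Pair_inject, goal_cases)
    case (1 b c cs)
    then show ?case using plus_right[of b cs c] by (simp add: o_def)
  next
    case (2 c b bs)
    then show ?case using plus_left[of c bs b] by (simp add: o_def)
  qed
  ultimately show ?case by (simp add: map_restrict)
qed

text \<open>A generator has one constant coordinate, and \<open>map_prod f g\<close> carries it to a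
  generator of the same kind.\<close>

lemma tensor_map_Hom:
  assumes "A \<in> Bipo" "A' \<in> Bipo" "B \<in> Bipo" "B' \<in> Bipo" and f: "f \<in> Hom A A'" and g: "g \<in> Hom B B'"
  shows "tensor_map A B f g \<in> Hom (A \<otimes> B) (A' \<otimes> B')"
  unfolding tensor_map_def
proof (rule restrict_Hom_tensorI)
  fix b c cs assume b: "b \<in> carrier A" "(c, cs) \<in> Rminus B"
  show "(map_prod f g (b, c), map (\<lambda>c. map_prod f g (b, c)) cs) \<in> Rminus (A' \<otimes> B')"
    using tensor_minus_right[OF Hom_closed[OF f b(1)] Hom_minus[OF g b(2)]] by (simp add: o_def)
next
  fix b c cs assume b: "c \<in> carrier B" "(b, cs) \<in> Rminus A"
  show "(map_prod f g (b, c), map (\<lambda>b. map_prod f g (b, c)) cs) \<in> Rminus (A' \<otimes> B')"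
    using tensor_minus_left[OF Hom_closed[OF g b(1)] Hom_minus[OF f b(2)]] by (simp add: o_def)
next
  fix b c cs assume b: "b \<in> carrier A" "(cs, c) \<in> Rplus B"
  show "(map (\<lambda>c. map_prod f g (b, c)) cs, map_prod f g (b, c)) \<in> Rplus (A' \<otimes> B')"
    using tensor_plus_right[OF Hom_closed[OF f b(1)] Hom_plus[OF g b(2)]] by (simp add: o_def)
next
  fix b c cs assume b: "c \<in> carrier B" "(cs, b) \<in> Rplus A"
  show "(map (\<lambda>b. map_prod f g (b, c)) cs, map_prod f g (b, c)) \<in> Rplus (A' \<otimes> B')"
    using tensor_plus_left[OF Hom_closed[OF g b(1)] Hom_plus[OF f b(2)]] by (simp add: o_def)
qed (use assms in \<open>auto simp: tensor_in_Bipo Hom_closed[OF f] Hom_closed[OF g]\<close>)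

lemma Bipo_tensor_functor: "Bipo_tensor_functor TYPE('a \<times> 'a2 \<times> 'a3 \<times> 'b \<times> 'b2 \<times> 'b3)"
  unfolding Bipo_tensor_functor_def
  by (auto simp: tensor_in_Bipo tensor_map_Hom)
    (auto simp: fun_eq_iff tensor_map_def bipo_id_def compose_def Hom_closed)

section \<open>Symmetry and associativity constraints\<close>

text \<open>Exchanging the factors exchanges the generators in the left variable with those in the
  right one.\<close>

lemma swap_map_Hom:
  assumes "A \<in> Bipo" "B \<in> Bipo"
  shows "swap_map A B \<in> Hom (A \<otimes> B) (B \<otimes> A)"
  unfolding swap_map_def
  by (rule restrict_Hom_tensorI)
    (use assms in \<open>auto simp: tensor_in_Bipo
      intro: tensor_minus_left tensor_minus_right tensor_plus_left tensor_plus_right\<close>)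

lemma swap_map_iso: "A \<in> Bipo \<Longrightarrow> B \<in> Bipo \<Longrightarrow> bipo_iso (A \<otimes> B) (B \<otimes> A) (swap_map A B)"
  by (rule bipo_isoI[OF swap_map_Hom swap_map_Hom]) (auto simp: swap_map_def)

text \<open>With the unit bipo as second factor, this insertion inverts \<open>runit_map\<close>;
  its counterpart on the right inverts \<open>lunit_map\<close>.\<close>

lemma tensor_section_left:
  assumes "B \<in> Bipo" "C \<in> Bipo" "c \<in> carrier C"
  shows "(\<lambda>b\<in>carrier B. (b, c)) \<in> Hom B (B \<otimes> C)"
  by (rule restrict_HomI) (use assms in \<open>auto intro: tensor_minus_left tensor_plus_left\<close>)

lemma tensor_section_right:
  assumes "B \<in> Bipo" "C \<in> Bipo" "b \<in> carrier B"
  shows "(\<lambda>c\<in>carrier C. (b, c)) \<in> Hom C (B \<otimes> C)"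
  by (rule restrict_HomI) (use assms in \<open>auto intro: tensor_minus_right tensor_plus_right\<close>)

text \<open>The associator with its third argument fixed. As a bipo map it transports arbitrary
  relations of A \<otimes> B, which is what the first variable of the associator calls for.\<close>

lemma tensor_section_left_left:
  assumes "A \<in> Bipo" "B \<in> Bipo" "C \<in> Bipo" "c \<in> carrier C"
  shows "(\<lambda>p\<in>carrier (A \<otimes> B). (fst p, (snd p, c))) \<in> Hom (A \<otimes> B) (A \<otimes> (B \<otimes> C))"
  unfolding carrier_tensor
proof (rule restrict_Hom_tensorI)
  fix b c' cs assume b: "b \<in> carrier A" "(c', cs) \<in> Rminus B"
  show "((fst (b, c'), snd (b, c'), c), map (\<lambda>c'. (fst (b, c'), snd (b, c'), c)) cs)
      \<in> Rminus (A \<otimes> (B \<otimes> C))"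
    using tensor_minus_right[OF b(1) tensor_minus_left[OF assms(4) b(2)]] by (simp add: o_def)
next
  fix b c' cs assume b: "b \<in> carrier A" "(cs, c') \<in> Rplus B"
  show "(map (\<lambda>c'. (fst (b, c'), snd (b, c'), c)) cs, (fst (b, c'), snd (b, c'), c))
      \<in> Rplus (A \<otimes> (B \<otimes> C))"
    using tensor_plus_right[OF b(1) tensor_plus_left[OF assms(4) b(2)]] by (simp add: o_def)
qed (use assms in \<open>auto simp: tensor_in_Bipo intro: tensor_minus_left tensor_plus_left\<close>)

lemma assoc_map_Hom:
  assumes A: "A \<in> Bipo" and B: "B \<in> Bipo" and C: "C \<in> Bipo"
  shows "assoc_map A B C \<in> Hom ((A \<otimes> B) \<otimes> C) (A \<otimes> (B \<otimes> C))"
proof -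
  let ?a = "\<lambda>((a, b), c). (a, (b, c))"
  have "restrict ?a (carrier (A \<otimes> B) \<times> carrier C) \<in> Hom ((A \<otimes> B) \<otimes> C) (A \<otimes> (B \<otimes> C))"
  proof (rule restrict_Hom_tensorI)
    fix p c cs assume p: "p \<in> carrier (A \<otimes> B)" "(c, cs) \<in> Rminus C"
    then obtain a b where "p = (a, b)" "a \<in> carrier A" "b \<in> carrier B" by auto
    then show "(?a (p, c), map (\<lambda>c. ?a (p, c)) cs) \<in> Rminus (A \<otimes> (B \<otimes> C))"
      using tensor_minus_right[OF _ tensor_minus_right[OF _ p(2)]] by (fastforce simp: o_def)
  next
    fix p c cs assume p: "p \<in> carrier (A \<otimes> B)" "(cs, c) \<in> Rplus C"
    then obtain a b where "p = (a, b)" "a \<in> carrier A" "b \<in> carrier B" by auto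
    then show "(map (\<lambda>c. ?a (p, c)) cs, ?a (p, c)) \<in> Rplus (A \<otimes> (B \<otimes> C))"
      using tensor_plus_right[OF _ tensor_plus_right[OF _ p(2)]] by (fastforce simp: o_def)
  next
    fix c p ps assume c: "c \<in> carrier C" and p: "(p, ps) \<in> Rminus (A \<otimes> B)"
    from Hom_minus[OF tensor_section_left_left[OF A B C c] p]
      Rminus_carrier[OF tensor_in_Bipo[OF A B] p]
    show "(?a (p, c), map (\<lambda>p. ?a (p, c)) ps) \<in> Rminus (A \<otimes> (B \<otimes> C))"
      by (simp add: map_restrict split_beta del: carrier_tensor)
  next
    fix c p ps assume c: "c \<in> carrier C" and p: "(ps, p) \<in> Rplus (A \<otimes> B)"
    from Hom_plus[OF tensor_section_left_left[OF A B C c] p]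
      Rplus_carrier[OF tensor_in_Bipo[OF A B] p]
    show "(map (\<lambda>p. ?a (p, c)) ps, ?a (p, c)) \<in> Rplus (A \<otimes> (B \<otimes> C))"
      by (simp add: map_restrict split_beta del: carrier_tensor)
  qed (use assms in \<open>auto simp: tensor_in_Bipo\<close>)
  then show ?thesis
    by (simp add: assoc_map_def)
qed

text \<open>By symmetry, the inverse of the associator is a conjugate of an associator.\<close>

lemma assoc_map_iso:
  assumes A: "A \<in> Bipo" and B: "B \<in> Bipo" and C: "C \<in> Bipo"
  shows "bipo_iso ((A \<otimes> B) \<otimes> C) (A \<otimes> (B \<otimes> C)) (assoc_map A B C)"
proof (rule bipo_isoI[OF assoc_map_Hom[OF assms]])
  let ?S = "A \<otimes> (B \<otimes> C)"
  \<comment> \<open>On elements: \<open>(a,(b,c))\<close>, \<open>((b,c),a)\<close>,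
    \<open>((c,b),a)\<close>, \<open>(c,(b,a))\<close>, \<open>(c,(a,b))\<close>,
    \<open>((a,b),c)\<close>.\<close>
  let ?inv = "swap_map C (A \<otimes> B) \<circ>\<^bsub>?S\<^esub> tensor_map C (B \<otimes> A) (bipo_id C) (swap_map B A)
    \<circ>\<^bsub>?S\<^esub> assoc_map C B A \<circ>\<^bsub>?S\<^esub> tensor_map (B \<otimes> C) A (swap_map B C) (bipo_id A)
    \<circ>\<^bsub>?S\<^esub> swap_map A (B \<otimes> C)"
  show "?inv \<in> Hom ?S ((A \<otimes> B) \<otimes> C)"
    by (intro bipo_comp_Hom[OF _ _ swap_map_Hom] bipo_comp_Hom[OF _ _ tensor_map_Hom]
        bipo_comp_Hom[OF _ _ assoc_map_Hom] tensor_in_Bipo bipo_id_Hom swap_map_Hom assms)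
  show "?inv (assoc_map A B C p) = p" if "p \<in> carrier ((A \<otimes> B) \<otimes> C)" for p
    using that by (auto simp: compose_def swap_map_def tensor_map_def assoc_map_def bipo_id_def)
  show "assoc_map A B C (?inv p) = p" if "p \<in> carrier ?S" for p
    using that by (auto simp: compose_def swap_map_def tensor_map_def assoc_map_def bipo_id_def)
qed

section \<open>The unit object, its constraints and coherence\<close>

text \<open>The only relations are reflexivities, so the substitution axioms replace each letter by
  itself and leave words unchanged.\<close>

lemma unit_bipo_in_Bipo: "unit_bipo \<in> Bipo"
proof (rule BipoI)
  have plus: "css = map (\<lambda>_. [()]) bs" if "list_all2 (\<lambda>cs b. (cs, b) \<in> Rplus unit_bipo) css bs"
    for css bs
    using that by (induction) (auto simp: unit_bipo_def)
  have minus: "css = map (\<lambda>_. [()]) bs" if "list_all2 (\<lambda>b cs. (b, cs) \<in> Rminus unit_bipo) bs css"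
    for css bs
    using that by (induction) (auto simp: unit_bipo_def)
  have concat: "concat (map (\<lambda>_. [()]) bs) = bs" for bs
    by (induction bs) auto
  show "(b, concat css) \<in> Rminus unit_bipo"
    if "(b, bs) \<in> Rminus unit_bipo" "list_all2 (\<lambda>b cs. (b, cs) \<in> Rminus unit_bipo) bs css" for b bs css
    using that(1) minus[OF that(2)] concat by simp
  show "(concat css, b) \<in> Rplus unit_bipo"
    if "(bs, b) \<in> Rplus unit_bipo" "list_all2 (\<lambda>cs b. (cs, b) \<in> Rplus unit_bipo) css bs" for b bs css
    using that(1) plus[OF that(2)] concat by simp
  show "(b, bs) \<in> Rminus unit_bipo"
    if "(b, concat css) \<in> Rminus unit_bipo" "list_all2 (\<lambda>cs b. (cs, b) \<in> Rplus unit_bipo) css bs"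
    for b bs css
    using that(1) plus[OF that(2)] concat by simp
  show "(bs, b) \<in> Rplus unit_bipo"
    if "(concat css, b) \<in> Rplus unit_bipo" "list_all2 (\<lambda>b cs. (b, cs) \<in> Rminus unit_bipo) bs css"
    for b bs css
    using that(1) minus[OF that(2)] concat by simp
  \<comment> \<open>A word over a one-letter alphabet is determined by its length.\<close>
  have permute: "permute_list \<sigma> cs = cs" for \<sigma> and cs :: "unit list"
    by (rule nth_equalityI) auto
  show "(c, cs) \<in> Rminus unit_bipo \<longleftrightarrow> (c, permute_list \<sigma> cs) \<in> Rminus unit_bipo" for c cs \<sigma>
    by (simp add: permute)
  show "(cs, c) \<in> Rplus unit_bipo \<longleftrightarrow> (permute_list \<sigma> cs, c) \<in> Rplus unit_bipo" for c cs \<sigma>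
    by (simp add: permute)
qed (auto simp: unit_bipo_def)

text \<open>Generators in the unit variable are reflexivities and go to reflexivities of
  \<open>A\<close>; those in the other variable are the relations of \<open>A\<close>
  itself.\<close>

lemma lunit_map_iso:
  assumes A: "A \<in> Bipo"
  shows "bipo_iso (unit_bipo \<otimes> A) A (lunit_map A)"
proof (rule bipo_isoI)
  show "lunit_map A \<in> Hom (unit_bipo \<otimes> A) A"
    unfolding lunit_map_def
    by (rule restrict_Hom_tensorI)
      (use A unit_bipo_in_Bipo in \<open>auto simp: unit_bipo_def intro: Rminus_refl Rplus_refl\<close>)
  show "(\<lambda>a\<in>carrier A. ((), a)) \<in> Hom A (unit_bipo \<otimes> A)"
    by (rule tensor_section_right[OF unit_bipo_in_Bipo A]) (simp add: unit_bipo_def)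
qed (auto simp: lunit_map_def unit_bipo_def)

lemma runit_map_iso:
  assumes A: "A \<in> Bipo"
  shows "bipo_iso (A \<otimes> unit_bipo) A (runit_map A)"
proof (rule bipo_isoI)
  show "runit_map A \<in> Hom (A \<otimes> unit_bipo) A"
    unfolding runit_map_def
    by (rule restrict_Hom_tensorI)
      (use A unit_bipo_in_Bipo in \<open>auto simp: unit_bipo_def intro: Rminus_refl Rplus_refl\<close>)
  show "(\<lambda>a\<in>carrier A. (a, ())) \<in> Hom A (A \<otimes> unit_bipo)"
    by (rule tensor_section_left[OF A unit_bipo_in_Bipo]) (simp add: unit_bipo_def)
qed (auto simp: runit_map_def unit_bipo_def)

lemma Bipo_monoidal_natural: "Bipo_monoidal_natural TYPE('a \<times> 'a2 \<times> 'b \<times> 'b2 \<times> 'c \<times> 'c2)"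
  unfolding Bipo_monoidal_natural_def
  by (intro conjI ballI assoc_map_iso swap_map_iso lunit_map_iso runit_map_iso)
    (auto simp: fun_eq_iff compose_def tensor_map_def assoc_map_def swap_map_def lunit_map_def
      runit_map_def bipo_id_def Hom_closed)

lemma Bipo_monoidal_coherent: "Bipo_monoidal_coherent TYPE('a \<times> 'b \<times> 'c \<times> 'd)"
  unfolding Bipo_monoidal_coherent_def
  by (intro conjI ballI)
    (auto simp: fun_eq_iff compose_def tensor_map_def assoc_map_def swap_map_def lunit_map_def
      runit_map_def bipo_id_def)

lemma Bipo_symmetric_monoidal: "Bipo_symmetric_monoidal TYPE('a \<times> 'b \<times> 'c \<times> 'd \<times> 'e \<times> 'f)"
  unfolding Bipo_symmetric_monoidal_def
  by (intro conjI unit_bipo_in_Bipo Bipo_tensor_functor Bipo_monoidal_natural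
      Bipo_monoidal_coherent)


section \<open>Internal Hom\<close>

lemma hom_bipo_eq_initial_bipo:
  "hom_bipo C D = initial_bipo (Hom C D) (carrier C) (\<lambda>c \<phi>. \<phi> c) (\<lambda>_. D)"
  by (simp add: hom_bipo_def initial_bipo_def)

lemma carrier_hom_bipo [simp]: "carrier (hom_bipo C D) = Hom C D"
  by (simp add: hom_bipo_eq_initial_bipo)

lemma hom_bipo_in_Bipo: "D \<in> Bipo \<Longrightarrow> hom_bipo C D \<in> Bipo"
  unfolding hom_bipo_eq_initial_bipo
  by (rule initial_bipo_in_Bipo) (auto simp: Hom_closed)

lemma hom_map_Hom:
  assumes C': "C' \<in> Bipo" and D: "D \<in> Bipo" and k: "k \<in> Hom C' C" and g: "g \<in> Hom D D'"
  shows "hom_map C' C D k g \<in> Hom (hom_bipo C D) (hom_bipo C' D')"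
proof -
  let ?m = "\<lambda>\<phi>. g \<circ>\<^bsub>C'\<^esub> \<phi> \<circ>\<^bsub>C'\<^esub> k"
  have m: "?m \<phi> \<in> Hom C' D'" if "\<phi> \<in> Hom C D" for \<phi>
    using that assms by (intro bipo_comp_Hom)
  have "restrict ?m (carrier (hom_bipo C D)) \<in> Hom (hom_bipo C D) (hom_bipo C' D')"
  proof (rule restrict_HomI[OF hom_bipo_in_Bipo[OF D]])
    fix \<phi> \<phi>s assume r: "(\<phi>, \<phi>s) \<in> Rminus (hom_bipo C D)"
    have "((?m \<phi>) c, map (\<lambda>\<phi>. (?m \<phi>) c) \<phi>s) \<in> Rminus D'" if c: "c \<in> carrier C'" for c
    proof -
      \<comment> \<open>The pointwise relation is used at \<open>k c\<close>; its image under
        \<open>g\<close> is the relation wanted at \<open>c\<close>.\<close>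
      have "(\<phi> (k c), map (\<lambda>\<phi>. \<phi> (k c)) \<phi>s) \<in> Rminus D"
        using r Hom_closed[OF k c] by (simp add: hom_bipo_eq_initial_bipo)
      from Hom_minus[OF g this] show ?thesis
        using c by (simp add: compose_def o_def)
    qed
    then show "(?m \<phi>, map ?m \<phi>s) \<in> Rminus (hom_bipo C' D')"
      using r m by (auto simp: hom_bipo_eq_initial_bipo o_def)
  next
    fix \<phi> \<phi>s assume r: "(\<phi>s, \<phi>) \<in> Rplus (hom_bipo C D)"
    have "(map (\<lambda>\<phi>. (?m \<phi>) c) \<phi>s, (?m \<phi>) c) \<in> Rplus D'" if c: "c \<in> carrier C'" for c
    proof -
      have "(map (\<lambda>\<phi>. \<phi> (k c)) \<phi>s, \<phi> (k c)) \<in> Rplus D"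
        using r Hom_closed[OF k c] by (simp add: hom_bipo_eq_initial_bipo)
      from Hom_plus[OF g this] show ?thesis
        using c by (simp add: compose_def o_def)
    qed
    then show "(map ?m \<phi>s, ?m \<phi>) \<in> Rplus (hom_bipo C' D')"
      using r m by (auto simp: hom_bipo_eq_initial_bipo o_def)
  qed (simp add: m)
  then show ?thesis
    by (simp add: hom_map_def)
qed

lemma hom_map_id:
  "hom_map C C D (bipo_id C) (bipo_id D) = bipo_id (hom_bipo C D)"
proof (rule extensionalityI)
  show "hom_map C C D (bipo_id C) (bipo_id D) \<in> extensional (Hom C D)"
    by (simp add: hom_map_def)
  show "bipo_id (hom_bipo C D) \<in> extensional (Hom C D)"
    by (simp add: bipo_id_def)
  fix \<phi> assume \<phi>: "\<phi> \<in> Hom C D"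
  have "bipo_id D \<circ>\<^bsub>C\<^esub> \<phi> \<circ>\<^bsub>C\<^esub> bipo_id C = \<phi>"
    by (rule extensionalityI[OF compose_extensional Hom_extensional[OF \<phi>]])
      (simp add: compose_def bipo_id_def Hom_closed[OF \<phi>])
  then show "hom_map C C D (bipo_id C) (bipo_id D) \<phi> = bipo_id (hom_bipo C D) \<phi>"
    using \<phi> by (simp add: hom_map_def bipo_id_def)
qed

lemma hom_map_comp:
  assumes "C' \<in> Bipo" "D \<in> Bipo" "k \<in> Hom C' C" "k' \<in> Hom C'' C'" "g \<in> Hom D D'" "g' \<in> Hom D' D''"
  shows "hom_map C'' C D (k \<circ>\<^bsub>C''\<^esub> k') (g' \<circ>\<^bsub>D\<^esub> g) =
    hom_map C'' C' D' k' g' \<circ>\<^bsub>hom_bipo C D\<^esub> hom_map C' C D k g"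
proof
  fix \<phi>
  \<comment> \<open>The outer \<open>hom_map\<close> is \<open>undefined\<close> off
    \<open>Hom C' D'\<close>, so the intermediate composite has to be placed there.\<close>
  have "g \<circ>\<^bsub>C'\<^esub> \<phi> \<circ>\<^bsub>C'\<^esub> k \<in> Hom C' D'" if "\<phi> \<in> Hom C D"
    using that assms by (intro bipo_comp_Hom)
  then show "hom_map C'' C D (k \<circ>\<^bsub>C''\<^esub> k') (g' \<circ>\<^bsub>D\<^esub> g) \<phi> =
      (hom_map C'' C' D' k' g' \<circ>\<^bsub>hom_bipo C D\<^esub> hom_map C' C D k g) \<phi>"
    using assms by (auto simp: fun_eq_iff hom_map_def compose_def Hom_closed)
qed

lemma Bipo_hom_functor: "Bipo_hom_functor TYPE('c \<times> 'c2 \<times> 'c3 \<times> 'd \<times> 'd2 \<times> 'd3)"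
  unfolding Bipo_hom_functor_def
  by (intro conjI ballI hom_bipo_in_Bipo hom_map_id hom_map_Hom hom_map_comp)

section \<open>Currying and the adjunction\<close>

text \<open>Generators in the variable \<open>C\<close> make each \<open>?c b\<close> a bipo map;
  generators in the variable \<open>B\<close> give the pointwise relations that make
  \<open>?c\<close> itself one.\<close>

lemma curry_map_Hom:
  assumes B: "B \<in> Bipo" and C: "C \<in> Bipo" and \<phi>: "\<phi> \<in> Hom (B \<otimes> C) D"
  shows "curry_map B C \<phi> \<in> Hom B (hom_bipo C D)"
proof -
  let ?c = "\<lambda>b. \<lambda>c\<in>carrier C. \<phi> (b, c)"
  have c: "?c b \<in> Hom C D" if "b \<in> carrier B" for b
    using Hom_minus[OF \<phi> tensor_minus_right[OF that]] Hom_plus[OF \<phi> tensor_plus_right[OF that]]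
    by (intro restrict_HomI[OF C]) (auto simp: o_def Hom_closed[OF \<phi>] that)
  show ?thesis
    unfolding curry_map_def
  proof (rule restrict_HomI[OF B])
    show "(?c b, map ?c bs) \<in> Rminus (hom_bipo C D)" if b: "(b, bs) \<in> Rminus B" for b bs
      using Rminus_carrier[OF B b] c Hom_minus[OF \<phi> tensor_minus_left[OF _ b]]
      by (auto simp: hom_bipo_eq_initial_bipo o_def)
    show "(map ?c bs, ?c b) \<in> Rplus (hom_bipo C D)" if b: "(bs, b) \<in> Rplus B" for b bs
      using Rplus_carrier[OF B b] c Hom_plus[OF \<phi> tensor_plus_left[OF _ b]]
      by (auto simp: hom_bipo_eq_initial_bipo o_def)
  qed (simp add: c)
qed

text \<open>For fixed \<open>b\<close>, relations in \<open>C\<close> are preserved because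
  \<open>\<psi> b\<close> is a bipo map; for fixed \<open>c\<close>, relations in \<open>B\<close>
  are the pointwise relations of \<open>hom_bipo C D\<close> evaluated at \<open>c\<close>.\<close>

lemma uncurry_map_Hom:
  assumes B: "B \<in> Bipo" and C: "C \<in> Bipo" and D: "D \<in> Bipo" and \<psi>: "\<psi> \<in> Hom B (hom_bipo C D)"
  shows "uncurry_map B C \<psi> \<in> Hom (B \<otimes> C) D"
proof -
  have \<psi>_Hom: "\<psi> b \<in> Hom C D" if "b \<in> carrier B" for b
    using Hom_closed[OF \<psi> that] by simp
  show ?thesis
    unfolding uncurry_map_def
    by (rule restrict_Hom_tensorI[OF B C D])
      (use \<psi>_Hom Hom_minus[OF \<psi>] Hom_plus[OF \<psi>] in
        \<open>auto simp: hom_bipo_eq_initial_bipo o_def intro: Hom_closed Hom_minus Hom_plus\<close>)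
qed

lemma uncurry_curry:
  assumes "\<phi> \<in> Hom (B \<otimes> C) D"
  shows "uncurry_map B C (curry_map B C \<phi>) = \<phi>"
  by (auto simp: fun_eq_iff uncurry_map_def curry_map_def restrict_def Hom_undefined[OF assms])

lemma curry_uncurry:
  assumes "\<psi> \<in> Hom B (hom_bipo C D)"
  shows "curry_map B C (uncurry_map B C \<psi>) = \<psi>"
proof (rule extensionalityI[OF _ Hom_extensional[OF assms]])
  show "curry_map B C (uncurry_map B C \<psi>) \<in> extensional (carrier B)"
    by (simp add: curry_map_def)
  fix b assume b: "b \<in> carrier B"
  then have \<psi>b: "\<psi> b \<in> Hom C D"
    using Hom_closed[OF assms] by simp
  \<comment> \<open>Curried maps are extensional at two levels; here the inner one is compared on
    the carrier of \<open>C\<close>.\<close>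
  show "curry_map B C (uncurry_map B C \<psi>) b = \<psi> b"
    using b by (intro extensionalityI[OF _ Hom_extensional[OF \<psi>b]])
      (simp_all add: curry_map_def uncurry_map_def)
qed

lemma curry_map_bij_betw:
  assumes "B \<in> Bipo" "C \<in> Bipo" "D \<in> Bipo"
  shows "bij_betw (curry_map B C) (Hom (B \<otimes> C) D) (Hom B (hom_bipo C D))"
  by (rule bij_betw_byWitness[where f' = "uncurry_map B C"])
    (use assms in \<open>auto simp: uncurry_curry curry_uncurry curry_map_Hom uncurry_map_Hom\<close>)

text \<open>At \<open>b\<close> and \<open>c\<close> in the carriers of \<open>B'\<close> and
  \<open>C'\<close>, both sides evaluate to \<open>g (\<phi> (f b, k c))\<close>.\<close>

lemma curry_map_natural:
  assumes "B \<in> Bipo" "C \<in> Bipo" "f \<in> Hom B' B" "k \<in> Hom C' C" "\<phi> \<in> Hom (B \<otimes> C) D"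
  shows "curry_map B' C' (g \<circ>\<^bsub>B' \<otimes> C'\<^esub> \<phi> \<circ>\<^bsub>B' \<otimes> C'\<^esub> tensor_map B' C' f k) =
    hom_map C' C D k g \<circ>\<^bsub>B'\<^esub> curry_map B C \<phi> \<circ>\<^bsub>B'\<^esub> f"
proof -
  \<comment> \<open>\<open>hom_map\<close> has its intended value only on members of
    \<open>Hom C D\<close>, so each section of \<phi> must be known to be one.\<close>
  have "(\<lambda>c\<in>carrier C. \<phi> (b, c)) \<in> Hom C D" if "b \<in> carrier B" for b
    using Hom_closed[OF curry_map_Hom[OF assms(1,2,5)] that] that by (simp add: curry_map_def)
  then show ?thesis
    using assms(3,4)
    by (auto simp: fun_eq_iff curry_map_def hom_map_def tensor_map_def compose_def Hom_closed)
qed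

lemma Bipo_adjunction: "Bipo_adjunction TYPE('b \<times> 'b2 \<times> 'c \<times> 'c2 \<times> 'd \<times> 'd2)"
  unfolding Bipo_adjunction_def
  by (intro conjI ballI curry_map_bij_betw uncurry_curry curry_uncurry curry_map_natural)

theorem proposition1:
  shows "(\<forall>B\<in>(Bipo :: 'b bipo set). \<forall>C\<in>(Bipo :: 'c bipo set). \<forall>D\<in>(Bipo :: 'd bipo set).
           bij_betw (\<lambda>\<phi>. \<lambda>b\<in>carrier B. \<lambda>c\<in>carrier C. \<phi> (b, c))
             (Hom (B \<otimes> C) D) (Hom B (hom_bipo C D)))
       \<and> Bipo_adjunction TYPE('b \<times> 'b2 \<times> 'c \<times> 'c2 \<times> 'd \<times> 'd2)
       \<and> Bipo_category TYPE('a \<times> 'b \<times> 'c \<times> 'd)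
       \<and> Bipo_complete TYPE('i \<times> 'm \<times> 'a \<times> 'e)
       \<and> Bipo_cocomplete TYPE('i \<times> 'm \<times> 'a \<times> 'e)
       \<and> Bipo_closed_symmetric_monoidal TYPE('a \<times> 'b \<times> 'c \<times> 'd \<times> 'e \<times> 'f)"
  \<comment> \<open>The first conjunct writes currying out as a function, so
    \<open>curry_map\<close> is unfolded as an abstraction to match it.\<close>
  by (intro conjI ballI curry_map_bij_betw[unfolded curry_map_def[abs_def]]
      Bipo_adjunction Bipo_category Bipo_complete Bipo_cocomplete
      Bipo_closed_symmetric_monoidal_def[THEN iffD2] Bipo_symmetric_monoidal Bipo_hom_functor)

end
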